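(* Let $1<p<\infty$, $s\in(1/p,1)$, and let $\Omega\subset\mathbb{R}^N$ be an open set. Suppose that $u\in W^{1,sp}(\Omega)\cap BMO(\Omega)$. Assume that there exist a function $f\in W^{1,sp}(\mathbb{R}^N)\cap BMO(\mathbb{R}^N)$ with $f=u$ almost everywhere in $\Omega$ and a constant $C_0=C_0(N,\Omega,p,s)$ such that $$\|f\|_{BMO(\mathbb{R}^N)}\le C_0\|u\|_{BMO(\Omega)},\qquad \|\nabla f\|_{L^{sp}(\mathbb{R}^N)}\le C_0\|\nabla u\|_{L^{sp}(\Omega)} .$$ Then $$\|u\|_{W^{s,p}(\Omega)}\le C\,\|\nabla u\|_{L^{sp}(\Omega)}^{s}\,\|u\|_{BMO(\Omega)}^{1-s},$$ where $C=C(s,p,N,\Omega)$ is a constant depending only on $s,p,N$ and the domain $\Omega$ (in particular, through the constant $C_0(N,\Omega,p,s)$, but not otherwise on $u$ or $f$).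
   Context: $W^{1,r}$ is the usual Sobolev space of functions in $L^r$ with weak gradient in $L^r$. The Gagliardo seminorm on a measurable set $E\subset\mathbb{R}^N$ is $$\|u\|_{W^{s,p}(E)}:=\left(\int_{E}\int_{E}\frac{|u(x)-u(z)|^p}{|x-z|^{sp+N}}dx\,dz\right)^{1/p}.$$ A cube is a Cartesian product of $N$ non-empty closed bounded intervals of the same (positive) length. For an open set $\Omega\subset\mathbb{R}^N$ (including $\Omega=\mathbb{R}^N$) and real-valued $u\in L^1_{\mathrm{loc}}(\Omega)$, $u\in BMO(\Omega)$ means that $$\|u\|_{BMO(\Omega)}:=\sup\left\{\frac{1}{\mathcal{L}^N(C)^2}\int_C\int_C|u(z)-u(y)|\,dy\,dz : C\subset \Omega\text{ a cube}\right\}<\infty ,$$ where $\mathcal{L}^N$ is Lebesgue measure. *)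

theory Defs
  imports "HOL-Analysis.Analysis"
begin

text \<open>
  All norms are \<^typ>\<open>ennreal\<close>-valued, so that they are meaningful before finiteness is known.
  The power below is only used with exponents \<open>a > 0\<close>.
\<close>

definition enn_powr :: "ennreal \<Rightarrow> real \<Rightarrow> ennreal" where
  "enn_powr x a = (if x = top then top else ennreal (enn2real x powr a))"

definition Lp_norm :: "real \<Rightarrow> 'a::euclidean_space set \<Rightarrow> ('a \<Rightarrow> 'b::real_normed_vector) \<Rightarrow> ennreal" where
  "Lp_norm r \<Omega> g = enn_powr (\<integral>\<^sup>+x\<in>\<Omega>. ennreal (norm (g x) powr r) \<partial>lebesgue) (1 / r)"

definition Lp_space :: "real \<Rightarrow> 'a::euclidean_space set \<Rightarrow> ('a \<Rightarrow> 'b::real_normed_vector) set" where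
  "Lp_space r \<Omega> = {g. set_borel_measurable lebesgue \<Omega> g \<and> Lp_norm r \<Omega> g < top}"

definition loc_integrable ::
  "'a::euclidean_space set \<Rightarrow> ('a \<Rightarrow> 'b::{banach, second_countable_topology}) \<Rightarrow> bool" where
  "loc_integrable \<Omega> g \<longleftrightarrow> (\<forall>K. compact K \<and> K \<subseteq> \<Omega> \<longrightarrow> set_integrable lebesgue K g)"

primrec cont_diff :: "nat \<Rightarrow> ('a::euclidean_space \<Rightarrow> real) \<Rightarrow> bool" where
  "cont_diff 0 \<phi> \<longleftrightarrow> continuous_on UNIV \<phi>"
| "cont_diff (Suc k) \<phi> \<longleftrightarrow> \<phi> differentiable_on UNIV \<and>
     (\<forall>i\<in>Basis. cont_diff k (\<lambda>x. frechet_derivative \<phi> (at x) i))"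

text \<open>Elements of \<open>C\<^sub>c\<^sup>\<infinity>(\<Omega>)\<close>, extended by zero to the whole space.\<close>

definition test_function :: "'a::euclidean_space set \<Rightarrow> ('a \<Rightarrow> real) \<Rightarrow> bool" where
  "test_function \<Omega> \<phi> \<longleftrightarrow> (\<forall>k. cont_diff k \<phi>) \<and>
     compact (closure {x. \<phi> x \<noteq> 0}) \<and> closure {x. \<phi> x \<noteq> 0} \<subseteq> \<Omega>"

definition has_weak_gradient ::
  "'a::euclidean_space set \<Rightarrow> ('a \<Rightarrow> real) \<Rightarrow> ('a \<Rightarrow> 'a) \<Rightarrow> bool" where
  "has_weak_gradient \<Omega> u g \<longleftrightarrow> loc_integrable \<Omega> u \<and> loc_integrable \<Omega> g \<and>
     (\<forall>\<phi>. test_function \<Omega> \<phi> \<longrightarrow> (\<forall>i\<in>Basis.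
        (LINT x:\<Omega>|lebesgue. u x * frechet_derivative \<phi> (at x) i)
          = - (LINT x:\<Omega>|lebesgue. (g x \<bullet> i) * \<phi> x)))"

definition sobolev_W1 :: "real \<Rightarrow> 'a::euclidean_space set \<Rightarrow> ('a \<Rightarrow> real) set" where
  "sobolev_W1 r \<Omega> = {u \<in> Lp_space r \<Omega>. \<exists>g \<in> Lp_space r \<Omega>. has_weak_gradient \<Omega> u g}"

text \<open>On the diagonal \<open>x = z\<close>, a null set, the quotient below is \<open>0 / 0 = 0\<close>.\<close>

definition gagliardo_seminorm ::
  "real \<Rightarrow> real \<Rightarrow> 'a::euclidean_space set \<Rightarrow> ('a \<Rightarrow> real) \<Rightarrow> ennreal" where
  "gagliardo_seminorm s p E u = enn_powr
     (\<integral>\<^sup>+z\<in>E. (\<integral>\<^sup>+x\<in>E.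
        ennreal (\<bar>u x - u z\<bar> powr p / norm (x - z) powr (s * p + real DIM('a)))
      \<partial>lebesgue) \<partial>lebesgue) (1 / p)"

definition cubes :: "'a::euclidean_space set set" where
  "cubes = {cbox a b | a b. \<exists>l>0. \<forall>i\<in>Basis. b \<bullet> i - a \<bullet> i = l}"

definition bmo_seminorm :: "'a::euclidean_space set \<Rightarrow> ('a \<Rightarrow> real) \<Rightarrow> ennreal" where
  "bmo_seminorm \<Omega> u = (SUP Q \<in> {Q \<in> cubes. Q \<subseteq> \<Omega>}.
     (\<integral>\<^sup>+z\<in>Q. (\<integral>\<^sup>+y\<in>Q. ennreal \<bar>u z - u y\<bar> \<partial>lebesgue) \<partial>lebesgue) / (emeasure lebesgue Q)\<^sup>2)"

definition BMO :: "'a::euclidean_space set \<Rightarrow> ('a \<Rightarrow> real) set" where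
  "BMO \<Omega> = {u. loc_integrable \<Omega> u \<and> bmo_seminorm \<Omega> u < top}"

end

theory Submission
  imports Defs
begin

text \<open>
  Write \<open>r = s p\<close>, \<open>N\<close> for the dimension and \<open>B\<close> for the BMO seminorm of the extension \<open>f\<close>; it suffices
  to bound the Gagliardo energy of \<open>f\<close> by \<open>K B powr (p - r)\<close> times the integral of \<open>|Df| powr r\<close>.

  Let \<open>O(t, x)\<close> be the mean oscillation of \<open>f\<close> over the cube \<open>x + t [0, 1]^N\<close>.  It is at most \<open>B\<close>, and by
  Poincare's inequality at most \<open>c t\<close> times the mean of \<open>|Df|\<close> over the cube.  Splitting \<open>|Df|\<close> at height
  \<open>B / t\<close> combines the two bounds into: \<open>O(t, x) powr p\<close> is at most a constant times the mean over the cube of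
  \<open>\<Phi>(t |Df|)\<close>, where \<open>\<Phi>(v) = v powr p\<close> for \<open>v \<le> B\<close> and \<open>\<Phi>(v) = B powr (p - 1) v\<close> for \<open>v > B\<close>.

  Telescoping over dyadic cubes that shrink to \<open>x\<close> and to \<open>y\<close> bounds \<open>|f x - f y|\<close>, for almost all \<open>x\<close>, \<open>y\<close>, by a
  sum of oscillations at the scales \<open>|x - y| / 2 ^ i\<close>.  Integrating the \<open>p\<close>-th power with weight
  \<open>|x - y| powr (- r - N)\<close>, Fubini reduces everything to the radial integral of
  \<open>\<Phi>(|h| a) |h| powr (- r - N)\<close> in \<open>h\<close>.  By scaling it equals a constant times \<open>B powr (p - r) a powr r\<close>, and the
  constant is finite because \<open>1 < r < p\<close>.

  Poincare's inequality follows from the identity of \<open>f (y + h) - f y\<close> with the integral of \<open>Df \<bullet> h\<close> over the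
  segment from \<open>y\<close> to \<open>y + h\<close>, valid for each \<open>h\<close> and almost every \<open>y\<close>, which is obtained by testing the weak
  gradient against smooth bumps that converge to indicators of boxes.
\<close>

section \<open>Truncated powers\<close>

text \<open>For \<open>0 \<le> v\<close> this is \<open>min v B powr (p - 1) * v\<close>. Order p at
  the origin and order 1 at infinity are exactly what the weight |h|^(-r-N) can integrate when 1 < r
  < p.\<close>

definition trunc_pow :: "real \<Rightarrow> real \<Rightarrow> real \<Rightarrow> real" where
  "trunc_pow p B v = (if v \<le> B then v powr p else B powr (p - 1) * v)"

lemma trunc_pow_nonneg: "0 \<le> v \<Longrightarrow> 0 \<le> trunc_pow p B v"
  by (auto simp: trunc_pow_def)

lemma measurable_trunc_pow [measurable]:
  assumes [measurable]: "f \<in> borel_measurable M"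
  shows "(\<lambda>x. trunc_pow p B (f x)) \<in> borel_measurable M"
  unfolding trunc_pow_def by measurable

text \<open>A convex graph lies above its tangent at \<open>m\<close>. Convexity is applied on the
  open half-line; at the endpoint \<open>v = 0\<close> the left side is (1 - p) m^p, which is not
  positive.\<close>

lemma powr_ge_tangent:
  fixes v m p :: real
  assumes "1 \<le> p" "0 \<le> v" "0 < m"
  shows "m powr p + p * m powr (p - 1) * (v - m) \<le> v powr p"
proof (cases "v = 0")
  case True
  have "m powr (p - 1) * m = m powr p"
    using assms by (simp add: powr_diff)
  then have "m powr p + p * m powr (p - 1) * (v - m) = (1 - p) * m powr p"
    using True by (simp add: algebra_simps)
  also have "\<dots> \<le> 0"
    using assms by (simp add: mult_nonpos_nonneg)
  finally show ?thesis
    using True by simp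
next
  case False
  have "p * m powr (p - 1) * (v - m) \<le> v powr p - m powr p"
  proof (rule convex_on_imp_above_tangent)
    show "convex_on {0<..} (\<lambda>x. x powr p)"
      using assms by (simp add: powr_convex)
    show "((\<lambda>x. x powr p) has_real_derivative p * m powr (p - 1)) (at m within {0<..})"
      using assms by (auto intro!: derivative_eq_intros)
  qed (use assms False in \<open>auto simp: interior_open\<close>)
  then show ?thesis by simp
qed

text \<open>Jensen's inequality, by integrating the tangent inequality at \<open>m\<close>. As
  \<open>m\<close> is only a lower bound of the mean, the mean itself may be infinite.\<close>

lemma powr_le_nn_integral_powr:
  fixes v :: "'a \<Rightarrow> real"
  assumes M: "emeasure M (space M) = 1" and [measurable]: "v \<in> borel_measurable M"
    and v: "\<And>x. 0 \<le> v x" and p: "1 \<le> p" and m: "0 \<le> m" "ennreal m \<le> (\<integral>\<^sup>+x. ennreal (v x) \<partial>M)"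
  shows "ennreal (m powr p) \<le> (\<integral>\<^sup>+x. ennreal (v x powr p) \<partial>M)"
proof (cases "m = 0")
  case False
  with m have m0: "0 < m" by simp
  let ?k = "p * m powr (p - 1)"
  have k0: "0 \<le> ?k" using p by simp
  \<comment> \<open>The terms are arranged without subtraction, so that the finite summand
    \<open>?k * m\<close> can be cancelled in the extended reals at the end.\<close>
  have "ennreal (?k * m) + ennreal (m powr p) = ennreal (m powr p) + ennreal ?k * ennreal m"
    using k0 m0 by (simp add: ennreal_mult' add.commute)
  also have "\<dots> \<le> ennreal (m powr p) + ennreal ?k * (\<integral>\<^sup>+x. ennreal (v x) \<partial>M)"
    by (intro add_left_mono mult_left_mono m) auto
  also have "\<dots> = (\<integral>\<^sup>+x. ennreal (m powr p) + ennreal ?k * ennreal (v x) \<partial>M)"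
    using M by (simp add: nn_integral_add nn_integral_cmult)
  also have "\<dots> \<le> (\<integral>\<^sup>+x. ennreal (?k * m) + ennreal (v x powr p) \<partial>M)"
  proof (rule nn_integral_mono)
    fix x
    have "m powr p + ?k * v x \<le> ?k * m + v x powr p"
      using powr_ge_tangent[OF p v m0, of x] by (simp add: algebra_simps)
    then have "ennreal (m powr p + ?k * v x) \<le> ennreal (?k * m + v x powr p)"
      by (rule ennreal_leI)
    then show "ennreal (m powr p) + ennreal ?k * ennreal (v x) \<le> ennreal (?k * m) + ennreal (v x powr p)"
      using k0 v m0 by (simp add: ennreal_plus ennreal_mult)
  qed
  also have "\<dots> = ennreal (?k * m) + (\<integral>\<^sup>+x. ennreal (v x powr p) \<partial>M)"
    using M by (simp add: nn_integral_add)
  finally show ?thesis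
    by (simp add: ennreal_add_left_cancel_le)
qed simp

text \<open>The part of \<open>v\<close> below the level \<open>B\<close> is handled by Jensen's inequality, the part above it
  by \<open>q powr p \<le> B powr (p - 1) * q\<close>; this replaces a maximal function estimate.\<close>

lemma powr_le_nn_integral_trunc_pow:
  fixes v :: "'a \<Rightarrow> real"
  assumes M: "emeasure M (space M) = 1" and v_meas [measurable]: "v \<in> borel_measurable M"
    and v: "\<And>x. 0 \<le> v x" and p: "1 < p" and q: "0 \<le> q" "q \<le> B" and c: "0 \<le> c"
    and le: "ennreal q \<le> ennreal c * (\<integral>\<^sup>+x. ennreal (v x) \<partial>M)"
  shows "ennreal (q powr p) \<le> ennreal ((2 * c) powr p + 2 * c) * (\<integral>\<^sup>+x. ennreal (trunc_pow p B (v x)) \<partial>M)"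
proof -
  define v1 where "v1 x = (if v x \<le> B then v x else 0)" for x
  define v2 where "v2 x = (if v x \<le> B then 0 else v x)" for x
  have [measurable]: "v1 \<in> borel_measurable M" "v2 \<in> borel_measurable M"
    unfolding v1_def[abs_def] v2_def[abs_def] by measurable
  have nn: "0 \<le> v1 x" "0 \<le> v2 x" for x
    using v by (auto simp: v1_def v2_def)
  define I1 where "I1 = (\<integral>\<^sup>+x. ennreal (v1 x) \<partial>M)"
  define I2 where "I2 = (\<integral>\<^sup>+x. ennreal (v2 x) \<partial>M)"
  define T where "T = (\<integral>\<^sup>+x. ennreal (trunc_pow p B (v x)) \<partial>M)"
  have "(\<integral>\<^sup>+x. ennreal (v x) \<partial>M) = (\<integral>\<^sup>+x. ennreal (v1 x) + ennreal (v2 x) \<partial>M)"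
    by (rule nn_integral_cong) (auto simp: v1_def v2_def)
  also have "\<dots> = I1 + I2"
    by (simp add: nn_integral_add I1_def I2_def)
  finally have sum: "(\<integral>\<^sup>+x. ennreal (v x) \<partial>M) = I1 + I2" .
  have B: "0 \<le> B" using q by simp
  \<comment> \<open>\<open>v1\<close> is bounded by \<open>B\<close> on a probability space, so its
    mean is a real number \<open>m\<close>, to which Jensen's inequality applies.\<close>
  have "I1 \<le> (\<integral>\<^sup>+x. ennreal B \<partial>M)"
    unfolding I1_def using B by (intro nn_integral_mono ennreal_leI) (auto simp: v1_def)
  then have "I1 \<le> ennreal B" using M by simp
  then have "I1 < top" using le_less_trans by fastforce
  then obtain m where m: "I1 = ennreal m" "0 \<le> m"
    by (metis ennreal_cases less_irrefl top.extremum_strict infinity_ennreal_def)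
  have dbl: "ennreal c * (2 * y) = ennreal (2 * c) * y" for y
    using c by (simp add: ennreal_mult' mult_ac)
  show ?thesis
  \<comment> \<open>The larger of the two means is at least half of their sum; this is where
    \<open>2 * c\<close> comes from.\<close>
  proof (cases "I2 \<le> I1")
    case True
    have "ennreal q \<le> ennreal c * (2 * I1)"
      using le True unfolding sum mult_2 by (meson add_left_mono dual_order.trans mult_left_mono zero_le)
    also have "\<dots> = ennreal (2 * c * m)"
      unfolding dbl m using c m by (simp add: ennreal_mult')
    finally have "q \<le> 2 * c * m"
      using c m q by (subst (asm) ennreal_le_iff) auto
    then have "q powr p \<le> (2 * c * m) powr p"
      using q p by (intro powr_mono2) auto
    also have "\<dots> = (2 * c) powr p * m powr p"
      using c m by (simp add: powr_mult)
    finally have "ennreal (q powr p) \<le> ennreal ((2 * c) powr p) * ennreal (m powr p)"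
      by (metis ennreal_leI ennreal_mult' powr_ge_zero)
    also have "ennreal (m powr p) \<le> (\<integral>\<^sup>+x. ennreal (v1 x powr p) \<partial>M)"
      using M nn p m by (intro powr_le_nn_integral_powr) (auto simp: I1_def)
    also have "\<dots> \<le> T"
      unfolding T_def by (intro nn_integral_mono ennreal_leI) (use B v in \<open>auto simp: v1_def trunc_pow_def\<close>)
    also have "ennreal ((2 * c) powr p) * T \<le> ennreal ((2 * c) powr p + 2 * c) * T"
      using c by (intro mult_right_mono ennreal_leI) auto
    finally show ?thesis
      by (simp add: T_def mult_left_mono)
  next
    case False
    then have "I1 \<le> I2" by simp
    then have "I1 + I2 \<le> 2 * I2"
      unfolding mult_2 by (rule add_right_mono)
    then have "ennreal q \<le> ennreal c * (2 * I2)"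
      using le unfolding sum by (meson dual_order.trans mult_left_mono zero_le)
    then have le2: "ennreal q \<le> ennreal (2 * c) * I2"
      unfolding dbl .
    have "q powr p = q powr (p - 1) * q"
      using q by (cases "q = 0") (auto simp: powr_diff)
    also have "\<dots> \<le> B powr (p - 1) * q"
      using q p by (intro mult_right_mono powr_mono2) auto
    finally have "ennreal (q powr p) \<le> ennreal (B powr (p - 1)) * ennreal q"
      by (metis ennreal_leI ennreal_mult' powr_ge_zero)
    also have "\<dots> \<le> ennreal (B powr (p - 1)) * (ennreal (2 * c) * I2)"
      using le2 by (rule mult_left_mono) simp
    also have "\<dots> = ennreal (2 * c) * (\<integral>\<^sup>+x. ennreal (B powr (p - 1)) * ennreal (v2 x) \<partial>M)"
      by (subst nn_integral_cmult) (simp_all add: I2_def mult_ac)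
    also have "\<dots> \<le> ennreal (2 * c) * T"
      unfolding T_def
      by (intro mult_left_mono nn_integral_mono)
        (use v in \<open>auto simp: v2_def trunc_pow_def ennreal_mult'[symmetric]\<close>)
    also have "\<dots> \<le> ennreal ((2 * c) powr p + 2 * c) * T"
      using c by (intro mult_right_mono ennreal_leI) auto
    finally show ?thesis
      by (simp add: T_def)
  qed
qed

section \<open>Behaviour of the Lebesgue integral under scaling and translation\<close>

lemma nn_integral_lborel_affine:
  fixes f :: "'a::euclidean_space \<Rightarrow> ennreal"
  assumes [measurable]: "f \<in> borel_measurable borel" and c: "c \<noteq> 0"
  shows "(\<integral>\<^sup>+x. f x \<partial>lborel) = ennreal (\<bar>c\<bar> ^ DIM('a)) * (\<integral>\<^sup>+x. f (t + c *\<^sub>R x) \<partial>lborel)"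
  by (subst lborel_affine[OF c, of t])
    (simp add: nn_integral_density nn_integral_distr nn_integral_cmult)

lemma nn_integral_lborel_translate:
  fixes f :: "'a::euclidean_space \<Rightarrow> ennreal"
  assumes [measurable]: "f \<in> borel_measurable borel"
  shows "(\<integral>\<^sup>+x. f (x + t) \<partial>lborel) = (\<integral>\<^sup>+x. f x \<partial>lborel)"
  using nn_integral_lborel_affine[of f 1 t] by (simp add: add.commute)

section \<open>Means and oscillations over cubes\<close>

text \<open>A probability space on which the mean over every cube x + t [0, 1]^N becomes the
  integral of f(x + t a) in a, without a normalising factor.\<close>

definition unit_cube :: "'a::euclidean_space measure" where
  "unit_cube = density lborel (indicator (cbox 0 One))"

lemma sets_unit_cube [measurable_cong, simp]: "sets unit_cube = sets borel"
  by (simp add: unit_cube_def)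

lemma space_unit_cube [simp]: "space unit_cube = UNIV"
  by (simp add: unit_cube_def)

lemma emeasure_unit_cube [simp]: "emeasure (unit_cube :: 'a::euclidean_space measure) UNIV = 1"
  by (simp add: unit_cube_def emeasure_density emeasure_lborel_cbox_eq)

interpretation unit_cube: finite_measure "unit_cube :: 'a::euclidean_space measure"
  by (rule finite_measureI) simp

lemma nn_integral_unit_cube:
  fixes f :: "'a::euclidean_space \<Rightarrow> ennreal"
  assumes [measurable]: "f \<in> borel_measurable borel"
  shows "(\<integral>\<^sup>+a. f a \<partial>unit_cube) = (\<integral>\<^sup>+a\<in>cbox 0 One. f a \<partial>lborel)"
  by (simp add: unit_cube_def nn_integral_density mult.commute)

lemma affine_mem_cube_iff:
  fixes a x :: "'a::euclidean_space"
  assumes "0 < t"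
  shows "x + t *\<^sub>R a \<in> cbox x (x + t *\<^sub>R One) \<longleftrightarrow> a \<in> cbox 0 One"
  using assms by (simp add: mem_box inner_simps zero_le_mult_iff)

lemma nn_integral_unit_cube_affine:
  fixes f :: "'a::euclidean_space \<Rightarrow> ennreal"
  assumes [measurable]: "f \<in> borel_measurable borel" and t: "0 < t"
  shows "ennreal (t ^ DIM('a)) * (\<integral>\<^sup>+a. f (x + t *\<^sub>R a) \<partial>unit_cube) =
    (\<integral>\<^sup>+y\<in>cbox x (x + t *\<^sub>R One). f y \<partial>lborel)"
proof -
  have "(\<integral>\<^sup>+y\<in>cbox x (x + t *\<^sub>R One). f y \<partial>lborel) = ennreal (t ^ DIM('a)) *
      (\<integral>\<^sup>+a. f (x + t *\<^sub>R a) * indicator (cbox x (x + t *\<^sub>R One)) (x + t *\<^sub>R a) \<partial>lborel)"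
    using t by (subst nn_integral_lborel_affine[where c=t and t=x]) auto
  also have "(\<lambda>a. indicator (cbox x (x + t *\<^sub>R One)) (x + t *\<^sub>R a) :: ennreal) = indicator (cbox 0 One)"
    using affine_mem_cube_iff[OF t, of x] by (auto simp: indicator_def fun_eq_iff)
  finally show ?thesis
    by (subst nn_integral_unit_cube) (simp_all add: fun_eq_iff)
qed

text \<open>Both means are integrals over their cubes divided by the volumes; the price of the
  larger domain is the ratio of the volumes.\<close>

lemma nn_integral_unit_cube_mono:
  fixes f :: "'a::euclidean_space \<Rightarrow> ennreal"
  assumes [measurable]: "f \<in> borel_measurable borel" and t: "0 < t" "0 < \<tau>"
    and sub: "cbox x (x + \<tau> *\<^sub>R One) \<subseteq> cbox z (z + t *\<^sub>R One)"
  shows "(\<integral>\<^sup>+a. f (x + \<tau> *\<^sub>R a) \<partial>unit_cube) \<le> ennreal ((t / \<tau>) ^ DIM('a)) * (\<integral>\<^sup>+a. f (z + t *\<^sub>R a) \<partial>unit_cube)"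
proof -
  let ?N = "DIM('a)"
  have "ennreal (\<tau> ^ ?N) * (\<integral>\<^sup>+a. f (x + \<tau> *\<^sub>R a) \<partial>unit_cube) \<le> ennreal (t ^ ?N) * (\<integral>\<^sup>+a. f (z + t *\<^sub>R a) \<partial>unit_cube)"
    unfolding nn_integral_unit_cube_affine[OF assms(1) t(1)] nn_integral_unit_cube_affine[OF assms(1) t(2)]
    using sub by (intro nn_integral_mono mult_left_mono) (auto simp: indicator_def)
  then have "ennreal (1 / \<tau> ^ ?N) * (ennreal (\<tau> ^ ?N) * (\<integral>\<^sup>+a. f (x + \<tau> *\<^sub>R a) \<partial>unit_cube))
      \<le> ennreal (1 / \<tau> ^ ?N) * (ennreal (t ^ ?N) * (\<integral>\<^sup>+a. f (z + t *\<^sub>R a) \<partial>unit_cube))"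
    by (rule mult_left_mono) simp
  then show ?thesis
    using t by (simp add: mult.assoc[symmetric] ennreal_mult'[symmetric] power_divide)
qed

text \<open>The quotient in the BMO seminorm for the cube with lower corner \<open>x\<close> and
  side \<open>t\<close>, as \<open>cube_osc_eq_nn_integral\<close> confirms.\<close>

definition cube_osc :: "('a::euclidean_space \<Rightarrow> real) \<Rightarrow> real \<Rightarrow> 'a \<Rightarrow> ennreal" where
  "cube_osc f t x = (\<integral>\<^sup>+a. (\<integral>\<^sup>+b. ennreal \<bar>f (x + t *\<^sub>R a) - f (x + t *\<^sub>R b)\<bar> \<partial>unit_cube) \<partial>unit_cube)"

lemma cube_osc_eq_nn_integral:
  fixes f :: "'a::euclidean_space \<Rightarrow> real"
  assumes [measurable]: "f \<in> borel_measurable borel" and t: "0 < t"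
  shows "ennreal (t ^ DIM('a)) * (ennreal (t ^ DIM('a)) * cube_osc f t x) =
    (\<integral>\<^sup>+y\<in>cbox x (x + t *\<^sub>R One). (\<integral>\<^sup>+z\<in>cbox x (x + t *\<^sub>R One). ennreal \<bar>f y - f z\<bar> \<partial>lborel) \<partial>lborel)"
proof -
  let ?Q = "cbox x (x + t *\<^sub>R One)"
  define T where "T = ennreal (t ^ DIM('a))"
  have "T * (T * cube_osc f t x) = T * (\<integral>\<^sup>+y\<in>?Q. (\<integral>\<^sup>+b. ennreal \<bar>f y - f (x + t *\<^sub>R b)\<bar> \<partial>unit_cube) \<partial>lborel)"
    unfolding T_def cube_osc_def using t
    by (subst nn_integral_unit_cube_affine[where f="\<lambda>y. \<integral>\<^sup>+b. ennreal \<bar>f y - f (x + t *\<^sub>R b)\<bar> \<partial>unit_cube", symmetric]) auto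
  also have "\<dots> = (\<integral>\<^sup>+y\<in>?Q. (T * (\<integral>\<^sup>+b. ennreal \<bar>f y - f (x + t *\<^sub>R b)\<bar> \<partial>unit_cube)) \<partial>lborel)"
    by (subst nn_integral_cmult[symmetric]) (auto simp: mult.assoc)
  also have "\<dots> = (\<integral>\<^sup>+y\<in>?Q. (\<integral>\<^sup>+z\<in>?Q. ennreal \<bar>f y - f z\<bar> \<partial>lborel) \<partial>lborel)"
    unfolding T_def using t by (subst nn_integral_unit_cube_affine) auto
  finally show ?thesis unfolding T_def .
qed

definition cube_mean :: "('a::euclidean_space \<Rightarrow> real) \<Rightarrow> real \<Rightarrow> 'a \<Rightarrow> real" where
  "cube_mean f t x = (\<integral>a. f (x + t *\<^sub>R a) \<partial>unit_cube)"

text \<open>The difference of two means is at most the double mean of the differences over the two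
  small cubes. Enlarging each cube to the common one costs one ratio of volumes.\<close>

lemma cube_mean_diff_le_cube_osc:
  fixes f :: "'a::euclidean_space \<Rightarrow> real"
  assumes f[measurable]: "f \<in> borel_measurable borel"
    and int: "\<And>x t. 0 < t \<Longrightarrow> integrable unit_cube (\<lambda>a. f (x + t *\<^sub>R a))"
    and t: "0 < t" "0 < \<tau>" "0 < \<sigma>"
    and sub: "cbox x (x + \<tau> *\<^sub>R One) \<subseteq> cbox z (z + t *\<^sub>R One)"
             "cbox y (y + \<sigma> *\<^sub>R One) \<subseteq> cbox z (z + t *\<^sub>R One)"
  shows "ennreal \<bar>cube_mean f \<tau> x - cube_mean f \<sigma> y\<bar>
    \<le> ennreal ((t / \<tau>) ^ DIM('a) * (t / \<sigma>) ^ DIM('a)) * cube_osc f t z"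
proof -
  have one: "measure (unit_cube :: 'a measure) UNIV = 1"
    by (simp add: measure_def)
  have sub_mean: "ennreal \<bar>cube_mean f \<tau> x - m\<bar> \<le> (\<integral>\<^sup>+a. ennreal \<bar>f (x + \<tau> *\<^sub>R a) - m\<bar> \<partial>unit_cube)"
    if "0 < \<tau>" for m \<tau> x
  proof -
    have "cube_mean f \<tau> x - m = (\<integral>a. f (x + \<tau> *\<^sub>R a) - m \<partial>unit_cube)"
      using int[OF that] one by (simp add: cube_mean_def)
    then show ?thesis
      using integral_norm_bound_ennreal[of unit_cube "\<lambda>a. f (x + \<tau> *\<^sub>R a) - m"] int[OF that, of x] by simp
  qed
  have "ennreal \<bar>cube_mean f \<tau> x - cube_mean f \<sigma> y\<bar>
      \<le> (\<integral>\<^sup>+a. ennreal \<bar>f (x + \<tau> *\<^sub>R a) - cube_mean f \<sigma> y\<bar> \<partial>unit_cube)"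
    by (rule sub_mean[OF t(2)])
  also have "\<dots> \<le> (\<integral>\<^sup>+a. (\<integral>\<^sup>+b. ennreal \<bar>f (x + \<tau> *\<^sub>R a) - f (y + \<sigma> *\<^sub>R b)\<bar> \<partial>unit_cube) \<partial>unit_cube)"
    using sub_mean[OF t(3)] by (intro nn_integral_mono) (subst (1 2) abs_minus_commute, simp)
  also have "\<dots> \<le> (\<integral>\<^sup>+a. ennreal ((t / \<sigma>) ^ DIM('a)) * (\<integral>\<^sup>+b. ennreal \<bar>f (x + \<tau> *\<^sub>R a) - f (z + t *\<^sub>R b)\<bar> \<partial>unit_cube) \<partial>unit_cube)"
    using t sub by (intro nn_integral_mono nn_integral_unit_cube_mono) auto
  also have "\<dots> \<le> ennreal ((t / \<tau>) ^ DIM('a)) * (\<integral>\<^sup>+a. ennreal ((t / \<sigma>) ^ DIM('a)) * (\<integral>\<^sup>+b. ennreal \<bar>f (z + t *\<^sub>R a) - f (z + t *\<^sub>R b)\<bar> \<partial>unit_cube) \<partial>unit_cube)"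
    using t sub by (intro nn_integral_unit_cube_mono[where f="\<lambda>v. ennreal ((t / \<sigma>) ^ DIM('a)) * (\<integral>\<^sup>+b. ennreal \<bar>f v - f (z + t *\<^sub>R b)\<bar> \<partial>unit_cube)"]) auto
  also have "\<dots> = ennreal ((t / \<tau>) ^ DIM('a) * (t / \<sigma>) ^ DIM('a)) * cube_osc f t z"
    using t by (simp add: nn_integral_cmult cube_osc_def ennreal_mult' mult.assoc)
  finally show ?thesis .
qed

lemma integrable_unit_cube_affine:
  fixes f :: "'a::euclidean_space \<Rightarrow> real"
  assumes [measurable]: "f \<in> borel_measurable borel"
    and int: "\<And>a b. set_integrable lborel (cbox a b) f" and t: "0 < t"
  shows "integrable unit_cube (\<lambda>a. f (x + t *\<^sub>R a))"
proof (rule integrableI_bounded)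
  have "ennreal (t ^ DIM('a)) * (\<integral>\<^sup>+a. ennreal (norm (f (x + t *\<^sub>R a))) \<partial>unit_cube)
      = (\<integral>\<^sup>+y\<in>cbox x (x + t *\<^sub>R One). ennreal (norm (f y)) \<partial>lborel)"
    using t by (intro nn_integral_unit_cube_affine) auto
  also have "\<dots> = (\<integral>\<^sup>+y. ennreal (norm (indicator (cbox x (x + t *\<^sub>R One)) y *\<^sub>R f y)) \<partial>lborel)"
    by (intro nn_integral_cong) (auto simp: indicator_def)
  also have "\<dots> < \<infinity>"
    using int[of x "x + t *\<^sub>R One"] unfolding set_integrable_def integrable_iff_bounded by simp
  finally show "(\<integral>\<^sup>+a. ennreal (norm (f (x + t *\<^sub>R a))) \<partial>unit_cube) < \<infinity>"
    using t by (auto simp: ennreal_mult_less_top)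
qed auto

lemma cube_mean_eq_integral:
  fixes f :: "'a::euclidean_space \<Rightarrow> real"
  assumes [measurable]: "f \<in> borel_measurable borel"
    and int: "\<And>a b. set_integrable lborel (cbox a b) f" and t: "0 < t"
  shows "t ^ DIM('a) * cube_mean f t x = integral (cbox x (x + t *\<^sub>R One)) f"
proof -
  have "integral (cbox x (x + t *\<^sub>R One)) f = (LINT y:cbox x (x + t *\<^sub>R One)|lborel. f y)"
    using set_borel_integral_eq_integral(2)[OF int] by simp
  also have "\<dots> = t ^ DIM('a) * (LINT a|lborel. indicator (cbox x (x + t *\<^sub>R One)) (x + t *\<^sub>R a) *\<^sub>R f (x + t *\<^sub>R a))"
    unfolding set_lebesgue_integral_def using t
    by (subst lborel_affine[where c=t and t=x])
      (simp_all add: integral_density integral_distr)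
  also have "(\<lambda>a. indicator (cbox x (x + t *\<^sub>R One)) (x + t *\<^sub>R a) :: real) = indicator (cbox 0 One)"
    using affine_mem_cube_iff[OF t, of x] by (auto simp: indicator_def fun_eq_iff)
  also have "(LINT a|lborel. indicator (cbox 0 One) a *\<^sub>R f (x + t *\<^sub>R a)) = cube_mean f t x"
    unfolding cube_mean_def unit_cube_def ennreal_indicator[symmetric]
    by (subst integral_density) auto
  finally show ?thesis by (simp add: fun_eq_iff)
qed

text \<open>Lebesgue's differentiation theorem for cubes that have \<open>x\<close> as their lower
  corner. The exceptional null set is the same for all \<open>t\<close>.\<close>

lemma AE_cube_mean_tendsto:
  fixes f :: "'a::euclidean_space \<Rightarrow> real"
  assumes f[measurable]: "f \<in> borel_measurable borel"
    and int: "\<And>a b. set_integrable lborel (cbox a b) f"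
  shows "AE x in lborel. \<forall>t>0. (\<lambda>n. cube_mean f (t / 2 ^ n) x) \<longlonglongrightarrow> f x"
proof -
  have "f integrable_on cbox a b" for a b
    using set_borel_integral_eq_integral(1)[OF int] .
  then obtain N where N: "negligible N" "\<And>x e. \<lbrakk>x \<notin> N; 0 < e\<rbrakk> \<Longrightarrow> \<exists>d>0. \<forall>h. 0 < h \<and> h < d \<longrightarrow>
                         norm (integral (cbox x (x + h *\<^sub>R One)) f /\<^sub>R h ^ DIM('a) - f x) < e"
    using integrable_ccontinuous_explicit by blast
  have "(\<lambda>n. cube_mean f (t / 2 ^ n) x) \<longlonglongrightarrow> f x" if xt: "x \<notin> N" "0 < t" for x t
  proof (rule LIMSEQ_I)
    fix e :: real assume "0 < e"
    then obtain d where d: "d > 0" "\<And>h. 0 < h \<and> h < d \<Longrightarrow> norm (integral (cbox x (x + h *\<^sub>R One)) f /\<^sub>R h ^ DIM('a) - f x) < e"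
      using N(2)[OF xt(1) \<open>0 < e\<close>] by blast
    have close: "norm (cube_mean f h x - f x) < e" if "0 < h" "h < d" for h
      using d(2)[of h] that cube_mean_eq_integral[OF f int that(1), of x, symmetric]
      by (simp add: mult.assoc[symmetric])
    have "(\<lambda>n. t * (1/2) ^ n) \<longlonglongrightarrow> t * 0"
      by (intro tendsto_mult tendsto_const LIMSEQ_realpow_zero) auto
    then have "eventually (\<lambda>n. t / 2 ^ n < d) sequentially"
      using order_tendstoD(2)[of "\<lambda>n. t * (1/2) ^ n" "t * 0" sequentially d] d(1)
      by (simp add: power_one_over)
    then obtain n0 where n0: "\<And>n. n \<ge> n0 \<Longrightarrow> t / 2 ^ n < d"
      by (auto simp: eventually_sequentially)
    show "\<exists>n0. \<forall>n\<ge>n0. norm (cube_mean f (t / 2 ^ n) x - f x) < e"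
    proof (intro exI allI impI)
      fix n assume "n0 \<le> n"
      show "norm (cube_mean f (t / 2 ^ n) x - f x) < e"
        using xt n0[OF \<open>n0 \<le> n\<close>] by (intro close) auto
    qed
  qed
  then have "AE x in lebesgue. \<forall>t>0. (\<lambda>n. cube_mean f (t / 2 ^ n) x) \<longlonglongrightarrow> f x"
    using N(1) unfolding negligible_iff_null_sets by (intro AE_I'[of N]) auto
  then show ?thesis by (simp add: AE_completion_iff)
qed

lemma AE_lborel_translate:
  fixes h :: "'a::euclidean_space"
  assumes "AE x in lborel. P x"
  shows "AE x in lborel. P (x + h)"
proof -
  obtain N where N: "{x. \<not> P x} \<subseteq> N" "emeasure lborel N = 0" "N \<in> sets borel"
    using AE_E[OF assms] by auto
  have [measurable]: "N \<in> sets borel" by fact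
  have "(\<integral>\<^sup>+x. indicator N (x + h) \<partial>lborel) = (0::ennreal)"
    using N by (subst nn_integral_lborel_translate) auto
  then have "AE x in lborel. indicator N (x + h) = (0::ennreal)"
    by (subst (asm) nn_integral_0_iff_AE) auto
  then show ?thesis
    by eventually_elim (use N(1) in \<open>auto simp: indicator_def split: if_splits\<close>)
qed

section \<open>Summation of oscillations over dyadic scales\<close>

lemma ennreal_le_suminf:
  fixes f :: "nat \<Rightarrow> ennreal"
  shows "f i \<le> (\<Sum>i. f i)"
proof -
  have "sum f {i} \<le> suminf f"
    by (rule sum_le_suminf) auto
  then show ?thesis by simp
qed

text \<open>This plays the role of Hoelder's inequality: if tau is the sum on the right, each single
  term gives a_i <= tau^(1/p) q^i, and these bounds form a geometric series.\<close>

lemma powr_le_suminf: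
  fixes a :: "nat \<Rightarrow> real"
  assumes a: "\<And>i. 0 \<le> a i" and p: "0 < p" and q: "0 < q" "q < 1" and S: "0 \<le> S"
    and le: "ennreal S \<le> (\<Sum>i. ennreal (a i))"
  shows "ennreal (S powr p) \<le> ennreal ((1 / (1 - q)) powr p) * (\<Sum>i. ennreal ((a i / q ^ i) powr p))"
    (is "_ \<le> ennreal ?K * ?T")
proof (cases "?T = top")
  case True
  then show ?thesis using q by (simp add: ennreal_mult_top)
next
  case False
  then obtain \<tau> where \<tau>: "?T = ennreal \<tau>" "0 \<le> \<tau>"
    by (metis ennreal_cases infinity_ennreal_def)
  have ai: "a i \<le> \<tau> powr (1 / p) * q ^ i" for i
  proof -
    have "ennreal ((a i / q ^ i) powr p) \<le> ?T"
      by (rule ennreal_le_suminf)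
    then have "(a i / q ^ i) powr p \<le> \<tau>"
      unfolding \<tau>(1) using \<tau>(2) by (simp only: ennreal_le_iff)
    then have "((a i / q ^ i) powr p) powr (1 / p) \<le> \<tau> powr (1 / p)"
      using p by (intro powr_mono2) auto
    then have "a i / q ^ i \<le> \<tau> powr (1 / p)"
      using p a[of i] q by (simp add: powr_powr)
    then show ?thesis
      using q by (simp add: field_simps)
  qed
  have sums: "(\<lambda>i. \<tau> powr (1 / p) * q ^ i) sums (\<tau> powr (1 / p) * (1 / (1 - q)))"
    using q by (intro sums_mult geometric_sums) auto
  have "ennreal S \<le> (\<Sum>i. ennreal (\<tau> powr (1 / p) * q ^ i))"
    using le ai by (meson dual_order.trans ennreal_leI suminf_le summableI)
  also have "\<dots> = ennreal (\<tau> powr (1 / p) * (1 / (1 - q)))"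
    using sums q by (intro suminf_ennreal_eq) auto
  finally have "S \<le> \<tau> powr (1 / p) * (1 / (1 - q))"
    using q by (subst (asm) ennreal_le_iff) auto
  then have "S powr p \<le> (\<tau> powr (1 / p) * (1 / (1 - q))) powr p"
    using S p by (intro powr_mono2) auto
  also have "\<dots> = ?K * \<tau>"
    using \<tau> p q by (simp add: powr_mult powr_powr mult.commute powr_divide)
  finally show ?thesis
    unfolding \<tau>(1) by (metis ennreal_leI ennreal_mult' powr_ge_zero)
qed

lemma mem_cube_iff:
  fixes x y :: "'a::euclidean_space"
  shows "y \<in> cbox x (x + t *\<^sub>R One) \<longleftrightarrow> (\<forall>i\<in>Basis. x \<bullet> i \<le> y \<bullet> i \<and> y \<bullet> i \<le> x \<bullet> i + t)"
  by (simp add: mem_box inner_simps)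

text \<open>Consecutive cubes share the corner \<open>x\<close> and are nested with ratio of volumes
  2^N, so each change of the mean is bounded by an oscillation at the larger scale.\<close>

lemma mean_telescope:
  fixes f :: "'a::euclidean_space \<Rightarrow> real"
  assumes f[measurable]: "f \<in> borel_measurable borel"
    and int: "\<And>a b. set_integrable lborel (cbox a b) f"
    and t: "0 < t" and lim: "(\<lambda>n. cube_mean f (t / 2 ^ n) x) \<longlonglongrightarrow> f x"
  shows "ennreal \<bar>f x - cube_mean f t x\<bar> \<le> ennreal (2 ^ DIM('a)) * (\<Sum>i. cube_osc f (t / 2 ^ i) x)"
proof -
  let ?c = "ennreal (2 ^ DIM('a))"
  have step: "ennreal \<bar>cube_mean f (t / 2 ^ i) x - cube_mean f (t / 2 ^ Suc i) x\<bar> \<le> ?c * cube_osc f (t / 2 ^ i) x" for i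
  proof -
    have "cbox x (x + (t / 2 ^ Suc i) *\<^sub>R One) \<subseteq> cbox x (x + (t / 2 ^ i) *\<^sub>R One)"
    proof
      fix y assume *: "y \<in> cbox x (x + (t / 2 ^ Suc i) *\<^sub>R One)"
      have "t / 2 ^ Suc i \<le> t / 2 ^ i" using t by (simp add: field_simps)
      with * show "y \<in> cbox x (x + (t / 2 ^ i) *\<^sub>R One)"
        unfolding mem_cube_iff by fastforce
    qed
    from cube_mean_diff_le_cube_osc[OF f integrable_unit_cube_affine[OF f int] _ _ _ _ this, of "t / 2 ^ i" x]
    show ?thesis using t by simp
  qed
  have tel: "ennreal \<bar>cube_mean f (t / 2 ^ n) x - cube_mean f t x\<bar> \<le> (\<Sum>i<n. ?c * cube_osc f (t / 2 ^ i) x)" for n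
  proof (induction n)
    case (Suc n)
    have "ennreal \<bar>cube_mean f (t / 2 ^ Suc n) x - cube_mean f t x\<bar>
        \<le> ennreal (\<bar>cube_mean f (t / 2 ^ n) x - cube_mean f t x\<bar> + \<bar>cube_mean f (t / 2 ^ n) x - cube_mean f (t / 2 ^ Suc n) x\<bar>)"
      by (intro ennreal_leI) linarith
    also have "\<dots> = ennreal \<bar>cube_mean f (t / 2 ^ n) x - cube_mean f t x\<bar> + ennreal \<bar>cube_mean f (t / 2 ^ n) x - cube_mean f (t / 2 ^ Suc n) x\<bar>"
      by (simp add: ennreal_plus)
    also have "\<dots> \<le> (\<Sum>i<n. ?c * cube_osc f (t / 2 ^ i) x) + ?c * cube_osc f (t / 2 ^ n) x"
      by (intro add_mono Suc.IH step)
    finally show ?case by simp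
  qed simp
  have bound: "ennreal \<bar>cube_mean f (t / 2 ^ n) x - cube_mean f t x\<bar> \<le> ?c * (\<Sum>i. cube_osc f (t / 2 ^ i) x)" for n
  proof -
    have "(\<Sum>i<n. ?c * cube_osc f (t / 2 ^ i) x) \<le> (\<Sum>i. ?c * cube_osc f (t / 2 ^ i) x)"
      by (rule sum_le_suminf) auto
    with tel[of n] show ?thesis by (simp add: ennreal_suminf_cmult)
  qed
  have "(\<lambda>n. ennreal \<bar>cube_mean f (t / 2 ^ n) x - cube_mean f t x\<bar>) \<longlonglongrightarrow> ennreal \<bar>f x - cube_mean f t x\<bar>"
    by (intro tendsto_intros lim)
  then show ?thesis
    by (rule LIMSEQ_le_const2) (use bound in blast)
qed

text \<open>Telescoping reduces the values at \<open>x\<close> and \<open>y\<close> to means over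
  cubes of side \<open>t\<close>. Coordinates of \<open>x\<close> and \<open>y\<close> differ by at
  most \<open>t\<close>, so both cubes lie in one cube of side \<open>3 * t\<close>; two ratios 3^N
  give \<open>9 ^ DIM('a)\<close>.\<close>

lemma diff_le_cube_osc:
  fixes f :: "'a::euclidean_space \<Rightarrow> real"
  assumes f[measurable]: "f \<in> borel_measurable borel"
    and int: "\<And>a b. set_integrable lborel (cbox a b) f"
    and t: "0 < t" "t = norm (y - x)"
    and lim: "(\<lambda>n. cube_mean f (t / 2 ^ n) x) \<longlonglongrightarrow> f x" "(\<lambda>n. cube_mean f (t / 2 ^ n) y) \<longlonglongrightarrow> f y"
  shows "ennreal \<bar>f x - f y\<bar> \<le> ennreal (2 ^ DIM('a)) * (\<Sum>i. cube_osc f (t / 2 ^ i) x)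
    + ennreal (2 ^ DIM('a)) * (\<Sum>i. cube_osc f (t / 2 ^ i) y)
    + ennreal (9 ^ DIM('a)) * cube_osc f (3 * t) (x - t *\<^sub>R One)"
proof -
  have y: "\<bar>y \<bullet> i - x \<bullet> i\<bar> \<le> t" if "i \<in> Basis" for i
    using Basis_le_norm[OF that, of "y - x"] t by (simp add: inner_simps)
  have "cbox x (x + t *\<^sub>R One) \<subseteq> cbox (x - t *\<^sub>R One) (x - t *\<^sub>R One + (3 * t) *\<^sub>R One)"
    using t(1) by (auto simp: mem_cube_iff inner_simps) (fastforce+)
  moreover have "cbox y (y + t *\<^sub>R One) \<subseteq> cbox (x - t *\<^sub>R One) (x - t *\<^sub>R One + (3 * t) *\<^sub>R One)"
  proof
    fix z assume *: "z \<in> cbox y (y + t *\<^sub>R One)"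
    show "z \<in> cbox (x - t *\<^sub>R One) (x - t *\<^sub>R One + (3 * t) *\<^sub>R One)"
      unfolding mem_cube_iff
    proof
      fix i :: 'a assume i: "i \<in> Basis"
      have "y \<bullet> i \<le> z \<bullet> i \<and> z \<bullet> i \<le> y \<bullet> i + t"
        using * i unfolding mem_cube_iff by blast
      then show "(x - t *\<^sub>R One) \<bullet> i \<le> z \<bullet> i \<and> z \<bullet> i \<le> (x - t *\<^sub>R One) \<bullet> i + 3 * t"
        using y[OF i] i by (simp add: inner_simps) linarith
    qed
  qed
  ultimately have "ennreal \<bar>cube_mean f t x - cube_mean f t y\<bar>
    \<le> ennreal ((3 * t / t) ^ DIM('a) * (3 * t / t) ^ DIM('a)) * cube_osc f (3 * t) (x - t *\<^sub>R One)"
    using t by (intro cube_mean_diff_le_cube_osc[OF f integrable_unit_cube_affine[OF f int]]) auto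
  also have "(3 * t / t) ^ DIM('a) * (3 * t / t) ^ DIM('a) = 9 ^ DIM('a)"
    using t by (simp add: power_mult_distrib[symmetric])
  finally have 3: "ennreal \<bar>cube_mean f t x - cube_mean f t y\<bar> \<le> ennreal (9 ^ DIM('a)) * cube_osc f (3 * t) (x - t *\<^sub>R One)" .
  have "ennreal \<bar>f x - f y\<bar> \<le> ennreal (\<bar>f x - cube_mean f t x\<bar> + \<bar>f y - cube_mean f t y\<bar> + \<bar>cube_mean f t x - cube_mean f t y\<bar>)"
    by (intro ennreal_leI) linarith
  also have "\<dots> = ennreal \<bar>f x - cube_mean f t x\<bar> + ennreal \<bar>f y - cube_mean f t y\<bar> + ennreal \<bar>cube_mean f t x - cube_mean f t y\<bar>"
    by (simp add: ennreal_plus)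
  also have "\<dots> \<le> ennreal (2 ^ DIM('a)) * (\<Sum>i. cube_osc f (t / 2 ^ i) x)
    + ennreal (2 ^ DIM('a)) * (\<Sum>i. cube_osc f (t / 2 ^ i) y)
    + ennreal (9 ^ DIM('a)) * cube_osc f (3 * t) (x - t *\<^sub>R One)"
    by (intro add_mono 3 mean_telescope f int t lim)
  finally show ?thesis .
qed

section \<open>The radial integral\<close>

text \<open>The shell of index k is covered by a cube of volume (4 rho_k)^N, which cancels the
  denominator rho_k^N. A geometric series of ratio 2^(-beta) remains.\<close>

lemma nn_integral_dyadic_shells_finite:
  fixes F :: "'a::euclidean_space \<Rightarrow> ennreal" and \<rho> :: "nat \<Rightarrow> real"
  assumes [measurable]: "F \<in> borel_measurable borel" and \<beta>: "0 < \<beta>" and \<rho>: "\<And>k. 0 < \<rho> k"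
    and A: "\<And>h. h \<in> A \<Longrightarrow> \<exists>k. norm h \<le> 2 * \<rho> k \<and> F h \<le> ennreal (2 powr (- \<beta> * real k) / \<rho> k ^ DIM('a))"
    and [measurable]: "A \<in> sets borel"
  shows "(\<integral>\<^sup>+h\<in>A. F h \<partial>lborel) < top"
proof -
  let ?Q = "\<lambda>k. cbox (- ((2 * \<rho> k) *\<^sub>R One)) ((2 * \<rho> k) *\<^sub>R (One :: 'a))"
  let ?b = "\<lambda>k. 2 powr (- \<beta> * real k) / \<rho> k ^ DIM('a)"
  have vol: "emeasure lborel (?Q k) = ennreal ((4 * \<rho> k) ^ DIM('a))" for k
    using \<rho>[of k] by (simp add: emeasure_lborel_cbox_eq inner_simps)
  have inQ: "h \<in> ?Q k" if "norm h \<le> 2 * \<rho> k" for h k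
  proof -
    have "\<bar>h \<bullet> i\<bar> \<le> 2 * \<rho> k" if "i \<in> Basis" for i
      using Basis_le_norm[OF that, of h] \<open>norm h \<le> _\<close> by simp
    then show ?thesis by (auto simp: mem_box abs_le_iff) (fastforce+)
  qed
  have "(\<integral>\<^sup>+h\<in>A. F h \<partial>lborel) \<le> (\<integral>\<^sup>+h. (\<Sum>k. ennreal (?b k) * indicator (?Q k) h) \<partial>lborel)"
  proof (rule nn_integral_mono)
    fix h
    show "F h * indicator A h \<le> (\<Sum>k. ennreal (?b k) * indicator (?Q k) h)"
    proof (cases "h \<in> A")
      case True
      then obtain k where k: "norm h \<le> 2 * \<rho> k" "F h \<le> ennreal (?b k)" using A by blast
      have "F h * indicator A h \<le> ennreal (?b k) * indicator (?Q k) h"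
        using k inQ[OF k(1)] True by simp
      also have "\<dots> \<le> (\<Sum>k. ennreal (?b k) * indicator (?Q k) h)"
        by (rule ennreal_le_suminf)
      finally show ?thesis .
    qed simp
  qed
  also have "\<dots> = (\<Sum>k. ennreal (?b k) * ennreal ((4 * \<rho> k) ^ DIM('a)))"
    by (subst nn_integral_suminf) (simp_all add: nn_integral_cmult_indicator vol power_mult_distrib)
  also have "\<dots> = (\<Sum>k. ennreal (4 ^ DIM('a) * (2 powr (- \<beta>)) ^ k))"
  proof (rule suminf_cong)
    fix k
    have "?b k * (4 * \<rho> k) ^ DIM('a) = 4 ^ DIM('a) * (2 powr (- \<beta>)) ^ k"
      using \<rho>[of k] by (simp add: power_mult_distrib powr_power mult.commute)
    then show "ennreal (?b k) * ennreal ((4 * \<rho> k) ^ DIM('a)) = ennreal (4 ^ DIM('a) * (2 powr (- \<beta>)) ^ k)"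
      using \<rho>[of k] by (subst ennreal_mult[symmetric]) auto
  qed
  also have "\<dots> < top"
  proof -
    have "2 powr (- \<beta>) < (1::real)" using \<beta> by (simp add: powr_less_one)
    then have "summable (\<lambda>k. 4 ^ DIM('a) * (2 powr (- \<beta>)) ^ k)"
      by (intro summable_mult summable_geometric) auto
    then show ?thesis by (subst suminf_ennreal2) auto
  qed
  finally show ?thesis .
qed

lemma ex_dyadic_ge:
  fixes u :: real
  assumes "1 \<le> u"
  shows "\<exists>k. 2 ^ k \<le> u \<and> u \<le> 2 * 2 ^ k"
proof -
  define n where "n = (LEAST n. u < 2 ^ n)"
  have "\<exists>n. u < 2 ^ n" using real_arch_pow[of 2 u] by auto
  then have n: "u < 2 ^ n" unfolding n_def by (rule LeastI_ex)
  have "n \<noteq> 0" using n assms by (cases n) auto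
  then obtain k where k: "n = Suc k" by (cases n) auto
  have "\<not> u < 2 ^ k" using not_less_Least[of k "\<lambda>n. u < 2 ^ n"] k unfolding n_def by auto
  then show ?thesis using n k by (intro exI[of _ k]) auto
qed

text \<open>The case \<open>B = 1\<close>, \<open>a = 1\<close> of the radial integral; the type
  argument only supplies the dimension.\<close>

definition radial_const :: "real \<Rightarrow> real \<Rightarrow> 'a::euclidean_space itself \<Rightarrow> ennreal" where
  "radial_const p r _ =
    (\<integral>\<^sup>+h. ennreal (trunc_pow p 1 (norm (h::'a)) / norm h powr (r + real DIM('a))) \<partial>lborel)"

lemma radial_const_finite:
  assumes "1 < r" "r < p"
  shows "radial_const p r TYPE('a::euclidean_space) < top"
proof -
  let ?N = "DIM('a)"
  let ?F = "\<lambda>h::'a. ennreal (trunc_pow p 1 (norm h) / norm h powr (r + real ?N))"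
  let ?A = "{h::'a. 0 < norm h \<and> norm h \<le> 1}" and ?B = "{h::'a. 1 < norm h}"
  have "(\<integral>\<^sup>+h\<in>?A. ?F h \<partial>lborel) < top"
  \<comment> \<open>On 2^(-k-1) <= |h| <= 2^(-k) the integrand is |h|^(p-r-N). The numerator is
    bounded at the outer radius, the denominator at the inner one, which is rho_k.\<close>
  proof (rule nn_integral_dyadic_shells_finite[where \<beta>="p - r" and \<rho>="\<lambda>k. (1/2) ^ Suc k"])
    fix h :: 'a assume h: "h \<in> ?A"
    define n where "n = norm h"
    have n: "0 < n" "n \<le> 1" using h by (auto simp: n_def)
    then obtain k where k: "2 ^ k \<le> 1 / n" "1 / n \<le> 2 * 2 ^ k"
      using ex_dyadic_ge[of "1 / n"] by auto
    have k': "n \<le> (1/2) ^ k" "(1/2) ^ Suc k \<le> n"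
      using k n by (auto simp: field_simps power_one_over)
    have "trunc_pow p 1 n / n powr (r + real ?N) = n powr (p - r) / n ^ ?N"
      using n by (simp add: trunc_pow_def powr_diff powr_add powr_realpow)
    also have "\<dots> \<le> ((1/2) ^ k) powr (p - r) / ((1/2) ^ Suc k) ^ ?N"
      using n k' assms by (intro frac_le powr_mono2 power_mono) auto
    also have "((1/2::real) ^ k) powr (p - r) = 2 powr (- (p - r) * real k)"
    proof -
      have "(1/2::real) ^ k = 2 powr (- real k)"
        by (simp add: powr_minus powr_realpow power_one_over inverse_eq_divide)
      then show ?thesis by (simp add: powr_powr algebra_simps)
    qed
    finally have "?F h \<le> ennreal (2 powr (- (p - r) * real k) / ((1/2) ^ Suc k) ^ ?N)"
      unfolding n_def by (rule ennreal_leI)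
    then show "\<exists>k. norm h \<le> 2 * (1/2) ^ Suc k \<and> ?F h \<le> ennreal (2 powr (- (p - r) * real k) / ((1/2) ^ Suc k) ^ ?N)"
      using k' by (auto simp: n_def)
  qed (use assms in auto)
  moreover have "(\<integral>\<^sup>+h\<in>?B. ?F h \<partial>lborel) < top"
  \<comment> \<open>On 2^k <= |h| <= 2^(k+1) the integrand is |h|^(1-r-N), and it is largest at the
    inner radius.\<close>
  proof (rule nn_integral_dyadic_shells_finite[where \<beta>="r - 1" and \<rho>="\<lambda>k. 2 ^ k"])
    fix h :: 'a assume h: "h \<in> ?B"
    define n where "n = norm h"
    have n: "1 < n" using h by (auto simp: n_def)
    then obtain k where k: "2 ^ k \<le> n" "n \<le> 2 * 2 ^ k"
      using ex_dyadic_ge[of "n"] by auto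
    have "trunc_pow p 1 n / n powr (r + real ?N) = n powr (- (r - 1)) / n ^ ?N"
      using n by (simp add: trunc_pow_def powr_diff powr_add powr_realpow)
    also have "\<dots> \<le> (2 ^ k) powr (- (r - 1)) / (2 ^ k) ^ ?N"
      using n k assms by (intro frac_le powr_mono2' power_mono) auto
    also have "(2 ^ k) powr (- (r - 1)) = 2 powr (- (r - 1) * real k)"
      by (simp add: powr_realpow[symmetric] powr_powr mult.commute)
    finally have "?F h \<le> ennreal (2 powr (- (r - 1) * real k) / (2 ^ k) ^ ?N)"
      unfolding n_def by (rule ennreal_leI)
    then show "\<exists>k. norm h \<le> 2 * 2 ^ k \<and> ?F h \<le> ennreal (2 powr (- (r - 1) * real k) / (2 ^ k) ^ ?N)"
      using k by (auto simp: n_def)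
  qed (use assms in auto)
  \<comment> \<open>The origin belongs to neither set; the integrand is 0 there.\<close>
  moreover have "radial_const p r TYPE('a) = (\<integral>\<^sup>+h\<in>?A. ?F h \<partial>lborel) + (\<integral>\<^sup>+h\<in>?B. ?F h \<partial>lborel)"
    unfolding radial_const_def
    by (subst nn_integral_add[symmetric]) (auto intro!: nn_integral_cong simp: indicator_def trunc_pow_def)
  ultimately show ?thesis by simp
qed

lemma trunc_pow_scale:
  assumes "0 < B" "0 \<le> v"
  shows "trunc_pow p B (B * v) = B powr p * trunc_pow p 1 v"
  using assms by (auto simp: trunc_pow_def powr_mult powr_diff)

text \<open>The substitution of (B/a) h for h turns \<open>B\<close> into 1. The powers collect to
  (B/a)^N B^p (B/a)^(-r-N) = B^(p-r) a^r. For \<open>a = 0\<close> both sides vanish.\<close>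

lemma radial_integral_trunc_pow:
  assumes B: "0 < B" and a: "0 \<le> a"
  shows "(\<integral>\<^sup>+h. ennreal (trunc_pow p B (norm (h::'a::euclidean_space) * a) / norm h powr (r + real DIM('a))) \<partial>lborel)
    = ennreal (B powr (p - r) * a powr r) * radial_const p r TYPE('a)"
proof (cases "a = 0")
  case True
  then show ?thesis using B by (simp add: trunc_pow_def)
next
  case False
  with a have a: "0 < a" by simp
  let ?N = "DIM('a)"
  let ?c = "B / a"
  have "(\<integral>\<^sup>+h. ennreal (trunc_pow p B (norm (h::'a) * a) / norm h powr (r + real ?N)) \<partial>lborel)
    = ennreal (\<bar>?c\<bar> ^ ?N) * (\<integral>\<^sup>+h. ennreal (trunc_pow p B (norm (0 + ?c *\<^sub>R (h::'a)) * a) / norm (0 + ?c *\<^sub>R h) powr (r + real ?N)) \<partial>lborel)"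
    using a B by (intro nn_integral_lborel_affine) auto
  also have "(\<lambda>h::'a. ennreal (trunc_pow p B (norm (0 + ?c *\<^sub>R h) * a) / norm (0 + ?c *\<^sub>R h) powr (r + real ?N)))
      = (\<lambda>h. ennreal (B powr p / ?c powr (r + real ?N)) * ennreal (trunc_pow p 1 (norm h) / norm h powr (r + real ?N)))"
  proof
    fix h :: 'a
    have "trunc_pow p B (norm (0 + ?c *\<^sub>R h) * a) = B powr p * trunc_pow p 1 (norm h)"
      using a B trunc_pow_scale[OF B, of "norm h" p] by simp
    moreover have "norm (0 + ?c *\<^sub>R h) powr (r + real ?N) = ?c powr (r + real ?N) * norm h powr (r + real ?N)"
    proof -
      have "norm (0 + ?c *\<^sub>R h) = ?c * norm h" using a B by simp
      then show ?thesis using a B by (simp only: powr_mult)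
    qed
    ultimately show "ennreal (trunc_pow p B (norm (0 + ?c *\<^sub>R h) * a) / norm (0 + ?c *\<^sub>R h) powr (r + real ?N))
      = ennreal (B powr p / ?c powr (r + real ?N)) * ennreal (trunc_pow p 1 (norm h) / norm h powr (r + real ?N))"
      by (subst ennreal_mult[symmetric]) (auto simp: trunc_pow_nonneg)
  qed
  also have "ennreal (\<bar>?c\<bar> ^ ?N) * (\<integral>\<^sup>+h. ennreal (B powr p / ?c powr (r + real ?N)) * ennreal (trunc_pow p 1 (norm (h::'a)) / norm h powr (r + real ?N)) \<partial>lborel)
      = ennreal (\<bar>?c\<bar> ^ ?N * (B powr p / ?c powr (r + real ?N))) * radial_const p r TYPE('a)"
  proof -
    have "ennreal (\<bar>?c\<bar> ^ ?N * (B powr p / ?c powr (r + real ?N)))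
        = ennreal (\<bar>?c\<bar> ^ ?N) * ennreal (B powr p / ?c powr (r + real ?N))"
      by (rule ennreal_mult') simp
    then show ?thesis
      unfolding radial_const_def by (subst nn_integral_cmult) (simp_all only: mult.assoc, auto)
  qed
  also have "\<bar>?c\<bar> ^ ?N * (B powr p / ?c powr (r + real ?N)) = B powr (p - r) * a powr r"
    using a B by (simp add: powr_add powr_realpow powr_divide powr_diff power_divide)
  finally show ?thesis .
qed

section \<open>From oscillation bounds to the Gagliardo energy\<close>

text \<open>All that the energy estimate needs from \<open>f\<close>: the BMO bound and the Poincare
  bound on oscillations. \<open>G\<close> stands for the length of the gradient, whose direction no
  longer matters.\<close>

locale oscillation_bounds =
  fixes f G :: "'a::euclidean_space \<Rightarrow> real" and p r B c :: real
  assumes f_meas [measurable]: "f \<in> borel_measurable borel"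
    and G_meas [measurable]: "G \<in> borel_measurable borel"
    and G_nonneg: "\<And>x. 0 \<le> G x"
    and f_int: "\<And>a b. set_integrable lborel (cbox a b) f"
    and r: "1 < r" and rp: "r < p" and B: "0 < B" and c: "0 \<le> c"
    and osc_le_B: "\<And>t x. 0 < t \<Longrightarrow> cube_osc f t x \<le> ennreal B"
    and osc_le_G: "\<And>t x. 0 < t \<Longrightarrow> cube_osc f t x \<le> ennreal c * (\<integral>\<^sup>+a. ennreal (t * G (x + t *\<^sub>R a)) \<partial>unit_cube)"
begin

lemma p: "1 < p"
  using r rp by simp

definition W :: "real \<Rightarrow> 'a \<Rightarrow> ennreal" where
  "W t x = (\<integral>\<^sup>+a. ennreal (trunc_pow p B (t * G (x + t *\<^sub>R a))) \<partial>unit_cube)"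

definition V :: "real \<Rightarrow> ennreal" where
  "V t = (\<integral>\<^sup>+y. ennreal (trunc_pow p B (t * G y)) \<partial>lborel)"

lemma measurable_W [measurable]:
  assumes [measurable]: "t \<in> borel_measurable M" "x \<in> borel_measurable M"
  shows "(\<lambda>w. W (t w) (x w)) \<in> borel_measurable M"
  unfolding W_def by measurable

lemma measurable_V [measurable]:
  assumes [measurable]: "t \<in> borel_measurable M"
  shows "(\<lambda>w. V (t w)) \<in> borel_measurable M"
  unfolding V_def by measurable

text \<open>This choice gives \<open>(1 / q) powr p * 2 powr (- r) = 2 powr (- r / 2) < 1\<close>, so the weights
  in the dyadic sum below are still summable after integration.\<close>

definition q :: real where "q = 2 powr (- r / (2 * p))"

lemma q: "0 < q" "q < 1"
  using r p by (auto simp: q_def powr_less_one)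

text \<open>The weights \<open>(1 / q ^ i) powr p\<close> are those of
  \<open>powr_le_suminf\<close>, applied to the oscillations at the scales t / 2^i.\<close>

definition S :: "real \<Rightarrow> 'a \<Rightarrow> ennreal" where
  "S t x = (\<Sum>i. ennreal ((1 / q ^ i) powr p) * W (t / 2 ^ i) x)"

lemma measurable_S [measurable]:
  assumes [measurable]: "t \<in> borel_measurable M" "x \<in> borel_measurable M"
  shows "(\<lambda>w. S (t w) (x w)) \<in> borel_measurable M"
  unfolding S_def by measurable

definition C1 :: real where "C1 = (2 * c) powr p + 2 * c"

lemma C1: "0 \<le> C1"
  using c by (simp add: C1_def)

text \<open>The BMO bound supplies \<open>q \<le> B\<close> and the Poincare bound the mean in
  \<open>powr_le_nn_integral_trunc_pow\<close>. The second claim records that the oscillation is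
  finite, so that passing to reals loses nothing.\<close>

lemma osc_powr_le:
  assumes t: "0 < t"
  shows "ennreal (enn2real (cube_osc f t x) powr p) \<le> ennreal C1 * W t x"
    and "ennreal (enn2real (cube_osc f t x)) = cube_osc f t x"
proof -
  have "cube_osc f t x < top"
    using osc_le_B[OF t, of x] by (simp add: le_less_trans)
  then show eq: "ennreal (enn2real (cube_osc f t x)) = cube_osc f t x"
    by simp
  have "enn2real (cube_osc f t x) \<le> B"
    using osc_le_B[OF t, of x] B by (simp add: enn2real_leI)
  then show "ennreal (enn2real (cube_osc f t x) powr p) \<le> ennreal C1 * W t x"
    unfolding C1_def W_def using t G_nonneg p c osc_le_G[OF t, of x]
    by (intro powr_le_nn_integral_trunc_pow) (auto simp: eq)
qed

lemma series_powr_le: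
  assumes t: "0 < t" and X: "0 \<le> X" and k: "0 \<le> k"
    and le: "ennreal X \<le> ennreal k * (\<Sum>i. cube_osc f (t / 2 ^ i) x)"
  shows "ennreal (X powr p) \<le> ennreal ((1 / (1 - q)) powr p * k powr p * C1) * S t x"
proof -
  define e where "e i = enn2real (cube_osc f (t / 2 ^ i) x)" for i
  have e0: "0 \<le> e i" for i by (simp add: e_def)
  have ti: "0 < t / 2 ^ i" for i using t by simp
  have "ennreal X \<le> (\<Sum>i. ennreal k * cube_osc f (t / 2 ^ i) x)"
    using le by (simp add: ennreal_suminf_cmult)
  also have "\<dots> = (\<Sum>i. ennreal (k * e i))"
    unfolding e_def using k by (intro suminf_cong) (simp only: ennreal_mult' osc_powr_le(2)[OF ti])
  finally have "ennreal (X powr p) \<le> ennreal ((1 / (1 - q)) powr p) * (\<Sum>i. ennreal ((k * e i / q ^ i) powr p))"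
    using X k e0 p q by (intro powr_le_suminf) auto
  also have "\<dots> \<le> ennreal ((1 / (1 - q)) powr p) * (\<Sum>i. ennreal (k powr p * C1) * (ennreal ((1 / q ^ i) powr p) * W (t / 2 ^ i) x))"
  proof (intro mult_left_mono suminf_le summableI)
    fix i
    have "(k * e i / q ^ i) powr p = (k powr p * (1 / q ^ i) powr p) * e i powr p"
    proof -
      have "k * e i / q ^ i = k * (1 / q ^ i) * e i" by simp
      then show ?thesis using k q e0[of i] by (simp only: powr_mult)
    qed
    then have "ennreal ((k * e i / q ^ i) powr p) = ennreal (k powr p * (1 / q ^ i) powr p) * ennreal (e i powr p)"
      by (simp only: ennreal_mult' powr_ge_zero mult_nonneg_nonneg)
    also have "\<dots> \<le> ennreal (k powr p * (1 / q ^ i) powr p) * (ennreal C1 * W (t / 2 ^ i) x)"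
      unfolding e_def by (intro mult_left_mono osc_powr_le ti) auto
    also have "\<dots> = ennreal (k powr p * C1) * (ennreal ((1 / q ^ i) powr p) * W (t / 2 ^ i) x)"
      using C1 by (simp only: ennreal_mult' powr_ge_zero) (simp only: mult_ac)
    finally show "ennreal ((k * e i / q ^ i) powr p) \<le> \<dots>" .
  qed auto
  also have "\<dots> = ennreal ((1 / (1 - q)) powr p * k powr p * C1) * S t x"
    unfolding S_def using C1 by (simp only: ennreal_suminf_cmult ennreal_mult' powr_ge_zero mult_nonneg_nonneg mult.assoc)
  finally show ?thesis .
qed

text \<open>\<open>3 powr p\<close> pays for keeping only one of three summands. The two constants
  in parentheses belong to the dyadic series and to the enclosing cube.\<close>

definition C2 :: real where
  "C2 = 3 powr p * ((1 / (1 - q)) powr p * (2 ^ DIM('a)) powr p * C1 + (9 ^ DIM('a)) powr p * C1)"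

lemma C2: "0 \<le> C2"
  using C1 by (simp add: C2_def)

lemma diff_powr_le:
  assumes t: "0 < t" "t = norm h"
    and lim: "(\<lambda>n. cube_mean f (t / 2 ^ n) x) \<longlonglongrightarrow> f x" "(\<lambda>n. cube_mean f (t / 2 ^ n) (x + h)) \<longlonglongrightarrow> f (x + h)"
  shows "ennreal (\<bar>f (x + h) - f x\<bar> powr p) \<le> ennreal C2 * (S t x + S t (x + h) + W (3 * t) (x - t *\<^sub>R One))"
proof -
  define D where "D = \<bar>f (x + h) - f x\<bar>"
  define A1 where "A1 = (1 / (1 - q)) powr p * (2 ^ DIM('a)) powr p * C1"
  define A2 where "A2 = (9 ^ DIM('a)) powr p * C1"
  have A: "0 \<le> A1" "0 \<le> A2" using C1 by (auto simp: A1_def A2_def)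
  define X where "X = ennreal (2 ^ DIM('a)) * (\<Sum>i. cube_osc f (t / 2 ^ i) x)"
  define Y where "Y = ennreal (2 ^ DIM('a)) * (\<Sum>i. cube_osc f (t / 2 ^ i) (x + h))"
  define Z where "Z = ennreal (9 ^ DIM('a)) * cube_osc f (3 * t) (x - t *\<^sub>R One)"
  let ?R = "S t x + S t (x + h) + W (3 * t) (x - t *\<^sub>R One)"
  have D: "0 \<le> D" by (simp add: D_def)
  have le: "ennreal D \<le> X + Y + Z"
    using diff_le_cube_osc[OF f_meas f_int t(1), of "x + h" x] t lim
    unfolding D_def X_def Y_def Z_def by (simp add: abs_minus_commute)
  \<comment> \<open>One of three summands with total at least D is at least D / 3, so a p-th power
    of a sum never has to be expanded.\<close>
  have "ennreal (D / 3) \<le> X \<or> ennreal (D / 3) \<le> Y \<or> ennreal (D / 3) \<le> Z"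
  proof (rule ccontr)
    assume "\<not> ?thesis"
    then have "X < ennreal (D / 3)" "Y < ennreal (D / 3)" "Z < ennreal (D / 3)" by auto
    then have "X + Y + Z < ennreal (D / 3) + ennreal (D / 3) + ennreal (D / 3)"
      by (intro add_strict_mono)
    also have "\<dots> = ennreal D"
      using D by (simp flip: ennreal_plus)
    finally show False using le by simp
  qed
  then have "ennreal ((D / 3) powr p) \<le> ennreal (A1 + A2) * ?R"
  proof (elim disjE)
    assume "ennreal (D / 3) \<le> X"
    then have "ennreal ((D / 3) powr p) \<le> ennreal A1 * S t x"
      unfolding A1_def X_def using D t by (intro series_powr_le) auto
    also have "\<dots> \<le> ennreal (A1 + A2) * ?R"
      using A by (intro mult_mono ennreal_leI) (auto simp: add.assoc intro: add_increasing2)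
    finally show ?thesis .
  next
    assume "ennreal (D / 3) \<le> Y"
    then have "ennreal ((D / 3) powr p) \<le> ennreal A1 * S t (x + h)"
      unfolding A1_def Y_def using D t by (intro series_powr_le) auto
    also have "\<dots> \<le> ennreal (A1 + A2) * ?R"
      using A by (intro mult_mono ennreal_leI) (auto intro: add_increasing add_increasing2)
    finally show ?thesis .
  next
    assume Z: "ennreal (D / 3) \<le> Z"
    define e where "e = enn2real (cube_osc f (3 * t) (x - t *\<^sub>R One))"
    have 3: "0 < 3 * t" using t by simp
    have "ennreal (D / 3) \<le> ennreal (9 ^ DIM('a) * e)"
      using Z osc_powr_le(2)[OF 3] unfolding Z_def e_def by (simp add: ennreal_mult')
    then have "D / 3 \<le> 9 ^ DIM('a) * e"
      by (subst (asm) ennreal_le_iff) (auto simp: e_def)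
    then have "(D / 3) powr p \<le> (9 ^ DIM('a) * e) powr p"
      using D p by (intro powr_mono2) auto
    also have "\<dots> = (9 ^ DIM('a)) powr p * e powr p"
      by (intro powr_mult)
    finally have "ennreal ((D / 3) powr p) \<le> ennreal ((9 ^ DIM('a)) powr p) * ennreal (e powr p)"
      by (metis ennreal_leI ennreal_mult' powr_ge_zero)
    also have "\<dots> \<le> ennreal ((9 ^ DIM('a)) powr p) * (ennreal C1 * W (3 * t) (x - t *\<^sub>R One))"
      unfolding e_def by (intro mult_left_mono osc_powr_le 3) auto
    also have "\<dots> = ennreal A2 * W (3 * t) (x - t *\<^sub>R One)"
      unfolding A2_def by (simp only: ennreal_mult' powr_ge_zero mult.assoc)
    also have "\<dots> \<le> ennreal (A1 + A2) * ?R"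
      using A by (intro mult_mono ennreal_leI) (auto intro: add_increasing add_increasing2)
    finally show ?thesis .
  qed
  then have "ennreal (3 powr p) * ennreal ((D / 3) powr p) \<le> ennreal (3 powr p) * (ennreal (A1 + A2) * ?R)"
    by (rule mult_left_mono) simp
  also have "\<dots> = ennreal C2 * ?R"
    unfolding C2_def A1_def A2_def by (simp only: ennreal_mult' powr_ge_zero mult.assoc)
  also have "ennreal (3 powr p) * ennreal ((D / 3) powr p) = ennreal (D powr p)"
    using D by (simp add: ennreal_mult'[symmetric] powr_mult[symmetric])
  finally show ?thesis unfolding D_def .
qed

section \<open>Integration over the base point and over the increment\<close>

lemma nn_integral_W:
  "(\<integral>\<^sup>+x. W t (x + u) \<partial>lborel) = V t"
proof -
  interpret pair_sigma_finite "lborel :: 'a measure" "unit_cube :: 'a measure" ..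
  have "(\<integral>\<^sup>+x. W t (x + u) \<partial>lborel) =
      (\<integral>\<^sup>+a. (\<integral>\<^sup>+x. ennreal (trunc_pow p B (t * G (x + u + t *\<^sub>R a))) \<partial>lborel) \<partial>unit_cube)"
    unfolding W_def by (subst Fubini') auto
  also have "\<dots> = (\<integral>\<^sup>+a. V t \<partial>(unit_cube :: 'a measure))"
    unfolding V_def
    by (rule nn_integral_cong)
      (use nn_integral_lborel_translate[of "\<lambda>y. ennreal (trunc_pow p B (t * G y))"] in \<open>simp add: add.assoc\<close>)
  finally show ?thesis by simp
qed

lemma nn_integral_S:
  "(\<integral>\<^sup>+x. S t (x + u) \<partial>lborel) = (\<Sum>i. ennreal ((1 / q ^ i) powr p) * V (t / 2 ^ i))"
  unfolding S_def by (subst nn_integral_suminf) (auto simp: nn_integral_cmult nn_integral_W)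

definition M :: ennreal where "M = (\<integral>\<^sup>+y. ennreal (G y powr r) \<partial>lborel)"

text \<open>After Fubini the inner integral in h is radial with slope l G(y); its homogeneity of
  degree r gives both \<open>l powr r\<close> and the integral \<open>M\<close>.\<close>

lemma nn_integral_V:
  assumes l: "0 < l"
  shows "(\<integral>\<^sup>+h. ennreal (1 / norm (h::'a) powr (r + real DIM('a))) * V (l * norm h) \<partial>lborel)
    = ennreal (l powr r) * (ennreal (B powr (p - r)) * radial_const p r TYPE('a) * M)"
proof -
  have "(\<integral>\<^sup>+h. ennreal (1 / norm (h::'a) powr (r + real DIM('a))) * V (l * norm h) \<partial>lborel)
    = (\<integral>\<^sup>+h. (\<integral>\<^sup>+y. ennreal (1 / norm (h::'a) powr (r + real DIM('a))) * ennreal (trunc_pow p B (l * norm h * G y)) \<partial>lborel) \<partial>lborel)"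
    unfolding V_def by (intro nn_integral_cong nn_integral_cmult[symmetric]) auto
  also have "\<dots> = (\<integral>\<^sup>+y. (\<integral>\<^sup>+h. ennreal (1 / norm (h::'a) powr (r + real DIM('a))) * ennreal (trunc_pow p B (l * norm h * G y)) \<partial>lborel) \<partial>lborel)"
    by (rule lborel_pair.Fubini') auto
  also have "\<dots> = (\<integral>\<^sup>+y. ennreal (B powr (p - r) * (l * G y) powr r) * radial_const p r TYPE('a) \<partial>lborel)"
  proof (rule nn_integral_cong)
    fix y
    have "(\<integral>\<^sup>+h. ennreal (1 / norm (h::'a) powr (r + real DIM('a))) * ennreal (trunc_pow p B (l * norm h * G y)) \<partial>lborel)
        = (\<integral>\<^sup>+h. ennreal (trunc_pow p B (norm (h::'a) * (l * G y)) / norm h powr (r + real DIM('a))) \<partial>lborel)"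
      using l G_nonneg[of y]
      by (intro nn_integral_cong) (simp add: ennreal_mult[symmetric] trunc_pow_nonneg mult_ac)
    also have "\<dots> = ennreal (B powr (p - r) * (l * G y) powr r) * radial_const p r TYPE('a)"
      using B l G_nonneg[of y] by (intro radial_integral_trunc_pow) auto
    finally show "(\<integral>\<^sup>+h. ennreal (1 / norm (h::'a) powr (r + real DIM('a))) * ennreal (trunc_pow p B (l * norm h * G y)) \<partial>lborel) = \<dots>" .
  qed
  also have "\<dots> = (\<integral>\<^sup>+y. ennreal (l powr r) * (ennreal (B powr (p - r)) * radial_const p r TYPE('a)) * ennreal (G y powr r) \<partial>lborel)"
  proof (rule nn_integral_cong)
    fix y
    have "B powr (p - r) * (l * G y) powr r = l powr r * B powr (p - r) * G y powr r"
      using l G_nonneg[of y] by (simp add: powr_mult)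
    then show "ennreal (B powr (p - r) * (l * G y) powr r) * radial_const p r TYPE('a)
        = ennreal (l powr r) * (ennreal (B powr (p - r)) * radial_const p r TYPE('a)) * ennreal (G y powr r)"
      by (simp only: ennreal_mult' powr_ge_zero mult_nonneg_nonneg) (simp only: mult_ac)
  qed
  also have "\<dots> = ennreal (l powr r) * (ennreal (B powr (p - r)) * radial_const p r TYPE('a) * M)"
    unfolding M_def by (subst nn_integral_cmult) (simp_all add: mult.assoc)
  finally show ?thesis .
qed

text \<open>The factor 2 counts the series at z and at z + h, the fraction sums the dyadic scales,
  and \<open>3 powr r\<close> stems from the enclosing cube of side 3 |h|.\<close>

definition C3 :: real where
  "C3 = C2 * (2 / (1 - 2 powr (- r / 2)) + 3 powr r)"

text \<open>Fubini moves the increment h to the outer integral. The pointwise estimate is then used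
  for one fixed h at a time, and its exceptional null set may depend on h.\<close>

theorem gagliardo_energy_le:
  "(\<integral>\<^sup>+z. (\<integral>\<^sup>+x. ennreal (\<bar>f x - f z\<bar> powr p / norm (x - z) powr (r + real DIM('a))) \<partial>lborel) \<partial>lborel)
    \<le> ennreal C3 * (ennreal (B powr (p - r)) * radial_const p r TYPE('a) * M)"
proof -
  let ?w = "\<lambda>h::'a. ennreal (1 / norm h powr (r + real DIM('a)))"
  let ?R = "ennreal (B powr (p - r)) * radial_const p r TYPE('a) * M"
  let ?v = "\<lambda>i. ennreal ((1 / q ^ i) powr p)"
  have "(\<integral>\<^sup>+z. (\<integral>\<^sup>+x. ennreal (\<bar>f x - f z\<bar> powr p / norm (x - z) powr (r + real DIM('a))) \<partial>lborel) \<partial>lborel)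
     = (\<integral>\<^sup>+z. (\<integral>\<^sup>+h. ?w h * ennreal (\<bar>f (z + h) - f z\<bar> powr p) \<partial>lborel) \<partial>lborel)"
  proof (rule nn_integral_cong)
    fix z :: 'a
    have "(\<integral>\<^sup>+x. ennreal (\<bar>f x - f z\<bar> powr p / norm (x - z) powr (r + real DIM('a))) \<partial>lborel)
      = (\<integral>\<^sup>+h. ennreal (\<bar>f (h + z) - f z\<bar> powr p / norm (h + z - z) powr (r + real DIM('a))) \<partial>lborel)"
      by (rule nn_integral_lborel_translate[symmetric]) auto
    also have "\<dots> = (\<integral>\<^sup>+h. ?w h * ennreal (\<bar>f (z + h) - f z\<bar> powr p) \<partial>lborel)"
      by (intro nn_integral_cong) (simp add: ennreal_mult[symmetric] add.commute)
    finally show "(\<integral>\<^sup>+x. ennreal (\<bar>f x - f z\<bar> powr p / norm (x - z) powr (r + real DIM('a))) \<partial>lborel) = \<dots>" .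
  qed
  also have "\<dots> = (\<integral>\<^sup>+h. (\<integral>\<^sup>+z. ?w h * ennreal (\<bar>f (z + h) - f z\<bar> powr p) \<partial>lborel) \<partial>lborel)"
    by (rule lborel_pair.Fubini') auto
  also have "\<dots> \<le> (\<integral>\<^sup>+h. ?w h * (ennreal C2 * (2 * (\<Sum>i. ?v i * V (norm h / 2 ^ i)) + V (3 * norm h))) \<partial>lborel)"
  proof (rule nn_integral_mono)
    fix h :: 'a
    show "(\<integral>\<^sup>+z. ?w h * ennreal (\<bar>f (z + h) - f z\<bar> powr p) \<partial>lborel)
        \<le> ?w h * (ennreal C2 * (2 * (\<Sum>i. ?v i * V (norm h / 2 ^ i)) + V (3 * norm h)))"
    \<comment> \<open>At \<open>h = 0\<close> the weight is 1 / 0 = 0, so both sides vanish.\<close>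
    proof (cases "h = 0")
      case False
      define t where "t = norm h"
      have t: "0 < t" using False by (simp add: t_def)
      have ae: "AE x in lborel. \<forall>t>0. (\<lambda>n. cube_mean f (t / 2 ^ n) x) \<longlonglongrightarrow> f x"
        by (rule AE_cube_mean_tendsto[OF f_meas f_int])
      \<comment> \<open>For almost every z, means converge both at z and at z + h. The forms
        \<open>z + 0\<close> and \<open>z + (- t *\<^sub>R One)\<close> are chosen to match
        \<open>nn_integral_S\<close> and \<open>nn_integral_W\<close>.\<close>
      have "(\<integral>\<^sup>+z. ennreal (\<bar>f (z + h) - f z\<bar> powr p) \<partial>lborel)
          \<le> (\<integral>\<^sup>+z. ennreal C2 * (S t (z + 0) + S t (z + h) + W (3 * t) (z + (- t *\<^sub>R One))) \<partial>lborel)"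
        using ae AE_lborel_translate[OF ae, of h]
        by (intro nn_integral_mono_AE, eventually_elim) (use t in \<open>auto intro!: diff_powr_le simp: t_def\<close>)
      also have "\<dots> = ennreal C2 * (2 * (\<Sum>i. ?v i * V (t / 2 ^ i)) + V (3 * t))"
        by (simp add: nn_integral_cmult nn_integral_add nn_integral_S nn_integral_W mult_2 del: add_0_right diff_conv_add_uminus add_uminus_conv_diff scaleR_minus_left)
      finally have "?w h * (\<integral>\<^sup>+z. ennreal (\<bar>f (z + h) - f z\<bar> powr p) \<partial>lborel)
          \<le> ?w h * (ennreal C2 * (2 * (\<Sum>i. ?v i * V (t / 2 ^ i)) + V (3 * t)))"
        by (rule mult_left_mono) simp
      then show ?thesis
        by (subst nn_integral_cmult) (auto simp: t_def)
    qed simp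
  qed
  also have "\<dots> = (\<integral>\<^sup>+h. ennreal C2 * (2 * (\<Sum>i. ?v i * (?w h * V ((1 / 2 ^ i) * norm h))) + ?w h * V (3 * norm h)) \<partial>lborel)"
  proof (rule nn_integral_cong)
    fix h :: 'a
    have "norm h / 2 ^ i = 1 / 2 ^ i * norm h" for i
      by simp
    then have "?w h * (\<Sum>i. ?v i * V (norm h / 2 ^ i)) = (\<Sum>i. ?v i * (?w h * V (1 / 2 ^ i * norm h)))"
      by (simp only: ennreal_suminf_cmult[symmetric] mult.left_commute[of "?w h"])
    moreover have "?w h * (ennreal C2 * (2 * s + v)) = ennreal C2 * (2 * (?w h * s) + ?w h * v)" for s v
      by (simp only: distrib_left mult.left_commute[of "?w h"])
    ultimately show "?w h * (ennreal C2 * (2 * (\<Sum>i. ?v i * V (norm h / 2 ^ i)) + V (3 * norm h)))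
        = ennreal C2 * (2 * (\<Sum>i. ?v i * (?w h * V (1 / 2 ^ i * norm h))) + ?w h * V (3 * norm h))"
      by (simp only:)
  qed
  also have "\<dots> = ennreal C2 * (2 * (\<Sum>i. ?v i * (ennreal ((1 / 2 ^ i) powr r) * ?R)) + ennreal (3 powr r) * ?R)"
  proof -
    have "(\<integral>\<^sup>+h. (\<Sum>i. ?v i * (?w h * V ((1 / 2 ^ i) * norm h))) \<partial>lborel) = (\<Sum>i. ?v i * (ennreal ((1 / 2 ^ i) powr r) * ?R))"
      by (subst nn_integral_suminf) (auto simp: nn_integral_cmult nn_integral_V simp del: times_divide_eq_left)
    moreover have "(\<integral>\<^sup>+h. ?w h * V (3 * norm h) \<partial>lborel) = ennreal (3 powr r) * ?R"
      by (rule nn_integral_V) simp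
    ultimately show ?thesis
      by (simp add: nn_integral_cmult nn_integral_add)
  qed
  also have "(\<Sum>i. ?v i * (ennreal ((1 / 2 ^ i) powr r) * ?R)) = ennreal (1 / (1 - 2 powr (- r / 2))) * ?R"
  proof -
    have qp: "q powr p = 2 powr (- r / 2)"
      using p by (simp add: q_def powr_powr)
    have 1: "(1 / q ^ i) powr p * (1 / 2 ^ i) powr r = (2 powr (- r / 2)) ^ i" for i
    proof -
      have "(1 / q ^ i) powr p = 1 / (q powr p) ^ i"
        using q by (simp add: powr_divide powr_power powr_realpow[symmetric] powr_powr mult.commute)
      moreover have "(1 / 2 ^ i) powr r = (2 powr (- r / 2)) ^ i * (2 powr (- r / 2)) ^ i"
        by (simp add: powr_divide powr_power powr_realpow[symmetric] powr_powr mult.commute powr_add[symmetric] powr_minus inverse_eq_divide)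
      ultimately show ?thesis by (simp add: qp)
    qed
    have "?v i * (ennreal ((1 / 2 ^ i) powr r) * ?R) = ennreal ((2 powr (- r / 2)) ^ i) * ?R" for i
      unfolding 1[symmetric] by (simp only: ennreal_mult' powr_ge_zero mult.assoc)
    moreover have "(\<Sum>i. ennreal ((2 powr (- r / 2)) ^ i)) = ennreal (1 / (1 - 2 powr (- r / 2)))"
    proof (rule suminf_ennreal_eq)
      have "2 powr (- r / 2) < 1" using r by (simp add: powr_less_one)
      then show "(\<lambda>i. (2 powr (- r / 2)) ^ i) sums (1 / (1 - 2 powr (- r / 2)))"
        by (intro geometric_sums) simp
    qed simp
    ultimately show ?thesis by simp
  qed
  also have "ennreal C2 * (2 * (ennreal (1 / (1 - 2 powr (- r / 2))) * ?R) + ennreal (3 powr r) * ?R) = ennreal C3 * ?R"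
  proof -
    have "2 powr (- r / 2) < 1" using r by (simp add: powr_less_one)
    then have "ennreal C3 = ennreal C2 * (2 * ennreal (1 / (1 - 2 powr (- r / 2))) + ennreal (3 powr r))"
      using C2 by (simp add: C3_def ennreal_mult' ennreal_plus numeral_mult_ennreal)
    then show ?thesis by (simp add: distrib_right mult.assoc)
  qed
  finally show ?thesis .
qed

end

section \<open>Smooth bumps on boxes\<close>

text \<open>Smoothness in one variable with the derivative as an existential witness, which makes
  closure under sums, products and affine substitution plain inductions.\<close>

primrec times_differentiable :: "nat \<Rightarrow> (real \<Rightarrow> real) \<Rightarrow> bool" where
  "times_differentiable 0 \<psi> \<longleftrightarrow> continuous_on UNIV \<psi>"
| "times_differentiable (Suc k) \<psi> \<longleftrightarrow>
    (\<exists>\<psi>'. (\<forall>x. (\<psi> has_real_derivative \<psi>' x) (at x)) \<and> times_differentiable k \<psi>')"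

lemma times_differentiable_SucI:
  assumes "\<And>x. (\<psi> has_real_derivative \<psi>' x) (at x)" "times_differentiable k \<psi>'"
  shows "times_differentiable (Suc k) \<psi>"
  using assms by auto

lemma times_differentiable_Suc: "times_differentiable (Suc k) \<psi> \<Longrightarrow> times_differentiable k \<psi>"
proof (induction k arbitrary: \<psi>)
  case 0
  then show ?case
    by (metis DERIV_isCont continuous_at_imp_continuous_on times_differentiable.simps)
next
  case (Suc k)
  then obtain \<psi>' where "\<forall>x. (\<psi> has_real_derivative \<psi>' x) (at x)" "times_differentiable (Suc k) \<psi>'"
    unfolding times_differentiable.simps(2)[of "Suc k"] by blast
  with Suc.IH[of \<psi>'] show ?case by auto
qed

lemma times_differentiable_add:
  "times_differentiable k \<phi> \<Longrightarrow> times_differentiable k \<psi> \<Longrightarrow> times_differentiable k (\<lambda>x. \<phi> x + \<psi> x)"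
proof (induction k arbitrary: \<phi> \<psi>)
  case (Suc k)
  then obtain \<phi>' \<psi>' where "\<forall>x. (\<phi> has_real_derivative \<phi>' x) (at x)" "times_differentiable k \<phi>'"
    "\<forall>x. (\<psi> has_real_derivative \<psi>' x) (at x)" "times_differentiable k \<psi>'"
    by auto
  with Suc.IH[of \<phi>' \<psi>'] show ?case
    by (auto intro!: exI[of _ "\<lambda>x. \<phi>' x + \<psi>' x"] derivative_eq_intros)
qed (auto intro: continuous_intros)

lemma times_differentiable_mult:
  "times_differentiable k \<phi> \<Longrightarrow> times_differentiable k \<psi> \<Longrightarrow> times_differentiable k (\<lambda>x. \<phi> x * \<psi> x)"
proof (induction k arbitrary: \<phi> \<psi>)
  case (Suc k)
  then obtain \<phi>' \<psi>' where "\<forall>x. (\<phi> has_real_derivative \<phi>' x) (at x)" "times_differentiable k \<phi>'"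
    "\<forall>x. (\<psi> has_real_derivative \<psi>' x) (at x)" "times_differentiable k \<psi>'"
    by auto
  moreover have "times_differentiable k \<phi>" "times_differentiable k \<psi>"
    using Suc.prems times_differentiable_Suc by blast+
  ultimately have "times_differentiable k (\<lambda>x. \<phi>' x * \<psi> x + \<psi>' x * \<phi> x)"
    "\<And>x. ((\<lambda>x. \<phi> x * \<psi> x) has_real_derivative \<phi>' x * \<psi> x + \<psi>' x * \<phi> x) (at x)"
    by (auto intro!: times_differentiable_add Suc.IH DERIV_mult)
  then show ?case by (rule_tac times_differentiable_SucI)
qed (auto intro: continuous_intros)

lemma times_differentiable_const: "times_differentiable k (\<lambda>x. c)"
  by (induction k arbitrary: c) (auto intro!: exI[of _ "\<lambda>x. 0"])

lemma times_differentiable_affine: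
  "times_differentiable k \<psi> \<Longrightarrow> times_differentiable k (\<lambda>x. \<psi> (m * x + c))"
proof (induction k arbitrary: \<psi>)
  case 0
  then show ?case
    by (auto intro!: continuous_on_compose2[of UNIV \<psi>] continuous_intros)
next
  case (Suc k)
  then obtain \<psi>' where \<psi>': "\<And>x. (\<psi> has_real_derivative \<psi>' x) (at x)" "times_differentiable k \<psi>'"
    by auto
  have "((\<lambda>x. \<psi> (m * x + c)) has_real_derivative \<psi>' (m * x + c) * m) (at x)" for x
    by (rule DERIV_chain2[OF \<psi>'(1)]) (auto intro!: derivative_eq_intros)
  moreover have "times_differentiable k (\<lambda>x. \<psi>' (m * x + c) * m)"
    by (intro times_differentiable_mult times_differentiable_const Suc.IH \<psi>')
  ultimately show ?case by (rule times_differentiable_SucI)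
qed

text \<open>\<open>flat 0\<close> is the standard smooth function exp(-1/t). The factors t^(-n) are
  included because the span of the family is closed under differentiation.\<close>

definition flat :: "nat \<Rightarrow> real \<Rightarrow> real" where
  "flat n t = (if 0 < t then (1 / t) ^ n * exp (- (1 / t)) else 0)"

lemma flat_tendsto_0: "(flat n \<longlongrightarrow> 0) (at 0)"
proof -
  have "filterlim (\<lambda>t::real. 1 / t) at_top (at_right 0)"
    using filterlim_inverse_at_top_right by (simp add: inverse_eq_divide)
  from filterlim_compose[OF tendsto_power_div_exp_0[of n] this]
  have "((\<lambda>t. (1 / t) ^ n / exp (1 / t)) \<longlongrightarrow> 0) (at_right (0::real))" .
  then have right: "(flat n \<longlongrightarrow> 0) (at_right 0)"
    by (rule Lim_transform_eventually)
      (auto simp: flat_def exp_minus field_simps eventually_at_right_field intro!: exI[of _ 1])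
  have "((\<lambda>t. 0) \<longlongrightarrow> 0) (at_left (0::real))"
    by simp
  then have left: "(flat n \<longlongrightarrow> 0) (at_left 0)"
    by (rule Lim_transform_eventually) (auto simp: flat_def eventually_at_left_field intro!: exI[of _ "-1"])
  show ?thesis
    using left right by (simp add: filterlim_split_at)
qed

text \<open>The derivative is a combination of members of the same family, so smoothness follows by
  induction for all \<open>n\<close> at once.\<close>

lemma flat_deriv: "(flat n has_real_derivative flat (n + 2) t + - real n * flat (n + 1) t) (at t)"
proof (cases t "0::real" rule: linorder_cases)
  case less
  have "((\<lambda>t. 0) has_real_derivative 0) (at t)" by simp
  then have "(flat n has_real_derivative 0) (at t)"
    by (rule has_field_derivative_transform_within_open[where S="{..<0}"]) (use less in \<open>auto simp: flat_def\<close>)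
  then show ?thesis using less by (simp add: flat_def)
next
  case equal
  \<comment> \<open>Away from 0 the difference quotient of \<open>flat n\<close> at 0 is
    \<open>flat (Suc n)\<close>.\<close>
  have "((\<lambda>y. (flat n y - flat n 0) / (y - 0)) \<longlongrightarrow> 0) (at 0)"
    using flat_tendsto_0[of "Suc n"]
    by (rule Lim_transform_eventually) (auto simp: flat_def eventually_at_filter)
  then show ?thesis
    unfolding equal by (simp add: has_field_derivative_iff flat_def)
next
  case greater
  have "((\<lambda>t. (1 / t) ^ n * exp (- (1 / t))) has_real_derivative flat (n + 2) t + - real n * flat (n + 1) t) (at t)"
  proof (cases n)
    case 0
    then show ?thesis using greater
      by (auto intro!: derivative_eq_intros simp: flat_def power2_eq_square)
  next
    case (Suc m)
    then show ?thesis using greater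
      by (auto intro!: derivative_eq_intros simp: flat_def power2_eq_square power_divide field_simps) (cases m; simp)
  qed
  then show ?thesis
    by (rule has_field_derivative_transform_within_open[where S="{0<..}"]) (use greater in \<open>auto simp: flat_def\<close>)
qed

lemma times_differentiable_flat: "times_differentiable k (flat n)"
proof (induction k arbitrary: n)
  case 0
  show ?case
    using flat_deriv by (auto intro!: continuous_at_imp_continuous_on DERIV_isCont)
next
  case (Suc k)
  have "times_differentiable k (\<lambda>t. flat (n + 2) t + - real n * flat (n + 1) t)"
    by (intro times_differentiable_add times_differentiable_mult times_differentiable_const Suc.IH)
  with flat_deriv show ?case by (rule times_differentiable_SucI)
qed

section \<open>Products of one-variable functions of the coordinates\<close>

lemma has_derivative_prod_coordinates:
  fixes \<psi> \<psi>' :: "'a::euclidean_space \<Rightarrow> real \<Rightarrow> real"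
  assumes "\<And>i t. i \<in> Basis \<Longrightarrow> (\<psi> i has_real_derivative \<psi>' i t) (at t)"
  shows "((\<lambda>x. \<Prod>i\<in>Basis. \<psi> i (x \<bullet> i)) has_derivative
    (\<lambda>y. \<Sum>j\<in>Basis. (y \<bullet> j) * (\<Prod>i\<in>Basis. (\<psi>(j := \<psi>' j)) i (x \<bullet> i)))) (at x)"
proof -
  have "((\<lambda>x. \<psi> i (x \<bullet> i)) has_derivative (\<lambda>y. \<psi>' i (x \<bullet> i) * (y \<bullet> i))) (at x)" if "i \<in> Basis" for i
  proof -
    have "((\<lambda>x. x \<bullet> i) has_derivative (\<lambda>y. y \<bullet> i)) (at x)"
      by (rule bounded_linear_imp_has_derivative[OF bounded_linear_inner_left])
    from has_derivative_compose[OF this assms[OF that, unfolded has_field_derivative_def]]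
    show ?thesis .
  qed
  then have "((\<lambda>x. \<Prod>i\<in>Basis. \<psi> i (x \<bullet> i)) has_derivative
    (\<lambda>y. \<Sum>j\<in>Basis. (\<psi>' j (x \<bullet> j) * (y \<bullet> j)) * (\<Prod>i\<in>Basis - {j}. \<psi> i (x \<bullet> i)))) (at x)"
    by (rule has_derivative_prod)
  moreover have "(\<Prod>i\<in>Basis. (\<psi>(j := \<psi>' j)) i (x \<bullet> i)) = \<psi>' j (x \<bullet> j) * (\<Prod>i\<in>Basis - {j}. \<psi> i (x \<bullet> i))"
    if "j \<in> Basis" for j
    using that by (subst prod.remove[of _ j]) (auto intro!: prod.cong)
  ultimately show ?thesis
    by (simp add: mult_ac cong: sum.cong)
qed

lemma frechet_derivative_prod_coordinates:
  fixes \<psi> \<psi>' :: "'a::euclidean_space \<Rightarrow> real \<Rightarrow> real"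
  assumes "\<And>i t. i \<in> Basis \<Longrightarrow> (\<psi> i has_real_derivative \<psi>' i t) (at t)" and j: "j \<in> Basis"
  shows "frechet_derivative (\<lambda>x. \<Prod>i\<in>Basis. \<psi> i (x \<bullet> i)) (at x) j = (\<Prod>i\<in>Basis. (\<psi>(j := \<psi>' j)) i (x \<bullet> i))"
proof -
  have "frechet_derivative (\<lambda>x. \<Prod>i\<in>Basis. \<psi> i (x \<bullet> i)) (at x)
      = (\<lambda>y. \<Sum>j\<in>Basis. (y \<bullet> j) * (\<Prod>i\<in>Basis. (\<psi>(j := \<psi>' j)) i (x \<bullet> i)))"
    by (rule frechet_derivative_at[OF has_derivative_prod_coordinates[of \<psi> \<psi>', OF assms(1)], symmetric])
  then have "frechet_derivative (\<lambda>x. \<Prod>i\<in>Basis. \<psi> i (x \<bullet> i)) (at x) j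
      = (\<Sum>l\<in>Basis. (j \<bullet> l) * (\<Prod>i\<in>Basis. (\<psi>(l := \<psi>' l)) i (x \<bullet> i)))"
    by (rule fun_cong)
  also have "\<dots> = (\<Sum>l\<in>Basis. if l = j then (\<Prod>i\<in>Basis. (\<psi>(l := \<psi>' l)) i (x \<bullet> i)) else 0)"
    by (intro sum.cong) (auto simp: inner_Basis j)
  also have "\<dots> = (\<Prod>i\<in>Basis. (\<psi>(j := \<psi>' j)) i (x \<bullet> i))"
    using j by simp
  finally show ?thesis .
qed

text \<open>A partial derivative of such a product is again such a product, with one factor replaced
  by its derivative; hence the induction runs over arbitrary families of factors.\<close>

lemma cont_diff_prod_coordinates:
  fixes \<psi> :: "'a::euclidean_space \<Rightarrow> real \<Rightarrow> real"
  assumes "\<And>i. i \<in> Basis \<Longrightarrow> times_differentiable k (\<psi> i)"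
  shows "cont_diff k (\<lambda>x. \<Prod>i\<in>Basis. \<psi> i (x \<bullet> i))"
  using assms
proof (induction k arbitrary: \<psi>)
  case 0
  have "continuous_on UNIV (\<lambda>x. x \<bullet> i)" for i :: 'a
    by (intro continuous_intros)
  then have "continuous_on UNIV (\<lambda>x. \<psi> i (x \<bullet> i))" if "i \<in> Basis" for i
    by (rule continuous_on_compose2[of UNIV "\<psi> i", rotated]) (use 0 that in auto)
  then show ?case
    by (simp add: continuous_on_prod)
next
  case (Suc k)
  then have "\<forall>i\<in>Basis. \<exists>\<psi>'. (\<forall>t. (\<psi> i has_real_derivative \<psi>' t) (at t)) \<and> times_differentiable k \<psi>'"
    by auto
  then obtain \<psi>' where "\<forall>i\<in>Basis. (\<forall>t. (\<psi> i has_real_derivative \<psi>' i t) (at t)) \<and> times_differentiable k (\<psi>' i)"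
    by metis
  then have \<psi>': "\<And>i t. i \<in> Basis \<Longrightarrow> (\<psi> i has_real_derivative \<psi>' i t) (at t)"
    "\<And>i. i \<in> Basis \<Longrightarrow> times_differentiable k (\<psi>' i)"
    by auto
  have "(\<lambda>x. \<Prod>i\<in>Basis. \<psi> i (x \<bullet> i)) differentiable_on UNIV"
    using has_derivative_prod_coordinates[of \<psi> \<psi>', OF \<psi>'(1)]
    by (auto simp: differentiable_on_def differentiable_def)
  moreover have "cont_diff k (\<lambda>x. frechet_derivative (\<lambda>x. \<Prod>i\<in>Basis. \<psi> i (x \<bullet> i)) (at x) j)" if j: "j \<in> Basis" for j
  proof -
    have "(\<lambda>x. frechet_derivative (\<lambda>x. \<Prod>i\<in>Basis. \<psi> i (x \<bullet> i)) (at x) j)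
        = (\<lambda>x. \<Prod>i\<in>Basis. (\<psi>(j := \<psi>' j)) i (x \<bullet> i))"
      by (rule ext, rule frechet_derivative_prod_coordinates) (use \<psi>' j in auto)
    moreover have "times_differentiable k (\<psi> i)" if "i \<in> Basis" for i
      by (rule times_differentiable_Suc) (rule Suc.prems[OF that])
    then have "cont_diff k (\<lambda>x. \<Prod>i\<in>Basis. (\<psi>(j := \<psi>' j)) i (x \<bullet> i))"
      by (intro Suc.IH) (use \<psi>'(2) j in auto)
    ultimately show ?thesis by (simp only:)
  qed
  ultimately show ?case by simp
qed

text \<open>The factor \<open>Suc n\<close> drives both exponentials to 1 inside the interval while
  the support stays in the same closed interval, so one box serves for the whole sequence.\<close>

definition bump1 :: "nat \<Rightarrow> real \<Rightarrow> real \<Rightarrow> real \<Rightarrow> real" where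
  "bump1 n \<alpha> \<beta> x = flat 0 (real (Suc n) * (x - \<alpha>)) * flat 0 (real (Suc n) * (\<beta> - x))"

definition bump :: "nat \<Rightarrow> 'a \<Rightarrow> 'a \<Rightarrow> 'a::euclidean_space \<Rightarrow> real" where
  "bump n a b x = (\<Prod>i\<in>Basis. bump1 n (a \<bullet> i) (b \<bullet> i) (x \<bullet> i))"

lemma times_differentiable_bump1: "times_differentiable k (bump1 n \<alpha> \<beta>)"
proof -
  have "times_differentiable k (\<lambda>x. flat 0 (real (Suc n) * x + (- real (Suc n) * \<alpha>)) * flat 0 (- real (Suc n) * x + real (Suc n) * \<beta>))"
    by (intro times_differentiable_mult times_differentiable_affine times_differentiable_flat)
  then show ?thesis
    unfolding bump1_def[abs_def] by (simp add: algebra_simps)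
qed

lemma flat_0_bounds: "0 \<le> flat 0 t" "flat 0 t \<le> 1"
  by (auto simp: flat_def)

lemma bump1_bounds: "0 \<le> bump1 n \<alpha> \<beta> x" "bump1 n \<alpha> \<beta> x \<le> 1"
  unfolding bump1_def using flat_0_bounds by (auto intro!: mult_nonneg_nonneg mult_le_one)

lemma bump_bounds: "0 \<le> bump n a b x" "bump n a b x \<le> 1"
  unfolding bump_def using bump1_bounds by (auto intro!: prod_nonneg prod_le_1)

lemma bump1_eq_0: "x \<notin> {\<alpha><..<\<beta>} \<Longrightarrow> bump1 n \<alpha> \<beta> x = 0"
  by (auto simp: bump1_def flat_def zero_less_mult_iff)

lemma bump_eq_0: "x \<notin> box a b \<Longrightarrow> bump n a b x = 0"
  unfolding bump_def mem_box by (rule prod_zero) (auto intro!: bump1_eq_0)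

lemma flat_0_tendsto_1:
  assumes "0 < u"
  shows "(\<lambda>n. flat 0 (real (Suc n) * u)) \<longlonglongrightarrow> 1"
proof -
  have "(\<lambda>n. exp (- (inverse (real (Suc n)) * (1 / u)))) \<longlonglongrightarrow> exp (- (0 * (1 / u)))"
    by (intro tendsto_intros LIMSEQ_inverse_real_of_nat)
  then show ?thesis
    using assms by (simp add: flat_def inverse_eq_divide)
qed

lemma bump_tendsto: "(\<lambda>n. bump n a b x) \<longlonglongrightarrow> indicator (box a b) x"
proof (cases "x \<in> box a b")
  case True
  have "(\<lambda>n. bump n a b x) \<longlonglongrightarrow> (\<Prod>i\<in>(Basis::'a set). 1 * 1)"
    unfolding bump_def bump1_def using True
    by (intro tendsto_prod tendsto_mult flat_0_tendsto_1) (auto simp: mem_box)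
  then show ?thesis using True by simp
qed (simp add: bump_eq_0)

lemma bump_translate: "bump n a b (x - h) = bump n (a + h) (b + h) x"
  by (simp add: bump_def bump1_def inner_simps algebra_simps)

lemma test_function_bump: "test_function UNIV (bump n a b)"
proof -
  have sub: "{x. bump n a b x \<noteq> 0} \<subseteq> cbox a b"
    using bump_eq_0 box_subset_cbox by blast
  then have "bounded {x. bump n a b x \<noteq> 0}"
    using bounded_cbox bounded_subset by blast
  moreover have "cont_diff k (bump n a b)" for k
    unfolding bump_def[abs_def] by (rule cont_diff_prod_coordinates) (rule times_differentiable_bump1)
  ultimately show ?thesis
    by (simp add: test_function_def compact_closure)
qed

section \<open>Weak gradients and difference quotients\<close>

lemma integrable_mult_compact_support:
  fixes f \<psi> :: "'a::euclidean_space \<Rightarrow> real"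
  assumes [measurable]: "f \<in> borel_measurable borel" "\<psi> \<in> borel_measurable borel"
    and f: "set_integrable lborel (cbox a b) f"
    and bound: "\<And>x. \<bar>\<psi> x\<bar> \<le> C" and supp: "\<And>x. x \<notin> cbox a b \<Longrightarrow> \<psi> x = 0"
  shows "integrable lborel (\<lambda>x. f x * \<psi> x)"
proof (rule Bochner_Integration.integrable_bound)
  show "integrable lborel (\<lambda>x. C * (indicator (cbox a b) x *\<^sub>R f x))"
    using f unfolding set_integrable_def by simp
  show "AE x in lborel. norm (f x * \<psi> x) \<le> norm (C * (indicator (cbox a b) x *\<^sub>R f x))"
  proof (rule AE_I2)
    fix x
    have "0 \<le> C" using bound[of x] by linarith
    then show "norm (f x * \<psi> x) \<le> norm (C * (indicator (cbox a b) x *\<^sub>R f x))"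
      using bound[of x] supp[of x]
      by (cases "x \<in> cbox a b") (auto simp: abs_mult mult.commute intro!: mult_right_mono)
  qed
qed measurable

lemma integral_lborel_translate:
  fixes f :: "'a::euclidean_space \<Rightarrow> real"
  assumes [measurable]: "f \<in> borel_measurable borel"
  shows "(\<integral>x. f (x + h) \<partial>lborel) = (\<integral>x. f x \<partial>lborel)"
proof -
  have "(\<integral>x. f x \<partial>lborel) = (\<integral>x. f x \<partial>distr lborel borel ((+) h))"
    by (simp only: lborel_distr_plus)
  also have "\<dots> = (\<integral>x. f (h + x) \<partial>lborel)"
    by (subst integral_distr) auto
  finally show ?thesis by (simp add: add.commute)
qed

lemma frechet_derivative_test_function:
  fixes \<phi> :: "'a::euclidean_space \<Rightarrow> real"
  assumes "test_function UNIV \<phi>"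
  shows "(\<phi> has_derivative frechet_derivative \<phi> (at x)) (at x)"
    and "continuous_on UNIV (\<lambda>x. frechet_derivative \<phi> (at x) h)"
    and "frechet_derivative \<phi> (at x) h = (\<Sum>i\<in>Basis. (h \<bullet> i) * frechet_derivative \<phi> (at x) i)"
proof -
  have cd: "cont_diff (Suc 0) \<phi>" using assms unfolding test_function_def by blast
  then have "\<phi> differentiable (at x)" for x
    by (auto simp: differentiable_on_def)
  then show D: "(\<phi> has_derivative frechet_derivative \<phi> (at x)) (at x)" for x
    by (simp add: frechet_derivative_works[symmetric])
  have lin: "linear (frechet_derivative \<phi> (at x))" for x
    using D has_derivative_linear by blast
  show eq: "frechet_derivative \<phi> (at x) h = (\<Sum>i\<in>Basis. (h \<bullet> i) * frechet_derivative \<phi> (at x) i)" for x h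
  proof -
    have "frechet_derivative \<phi> (at x) h = frechet_derivative \<phi> (at x) (\<Sum>i\<in>Basis. (h \<bullet> i) *\<^sub>R i)"
      by (simp add: euclidean_representation)
    also have "\<dots> = (\<Sum>i\<in>Basis. (h \<bullet> i) * frechet_derivative \<phi> (at x) i)"
      using lin[of x] by (simp add: linear_sum linear_scale)
    finally show ?thesis .
  qed
  show "continuous_on UNIV (\<lambda>x. frechet_derivative \<phi> (at x) h)"
    unfolding eq[of _ h] using cd by (intro continuous_on_sum continuous_on_mult continuous_on_const) auto
qed

lemma bump_eq_0': "x \<notin> cbox a b \<Longrightarrow> bump n a b x = 0"
  using bump_eq_0 box_subset_cbox by blast

lemma frechet_derivative_bump_eq_0:
  assumes "x \<notin> cbox a b"
  shows "frechet_derivative (bump n a b) (at x) h = 0"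
proof -
  have "((\<lambda>x. 0::real) has_derivative (\<lambda>h. 0)) (at x)" by simp
  then have "(bump n a b has_derivative (\<lambda>h. 0)) (at x)"
    by (rule has_derivative_transform_within_open[where s="- cbox a b"])
      (use assms in \<open>auto simp: bump_eq_0' closed_cbox\<close>)
  from frechet_derivative_at[OF this] show ?thesis by (metis)
qed

lemma frechet_derivative_bump_translate:
  "frechet_derivative (bump n a b) (at (x - h)) = frechet_derivative (bump n (a + h) (b + h)) (at x)"
proof -
  have "((\<lambda>x. x - h) has_derivative (\<lambda>y. y)) (at x)"
    by (auto intro!: derivative_eq_intros)
  from has_derivative_compose[OF this frechet_derivative_test_function(1)[OF test_function_bump]]
  have "((\<lambda>x. bump n a b (x - h)) has_derivative frechet_derivative (bump n a b) (at (x - h))) (at x)" .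
  then show ?thesis
    unfolding bump_translate using frechet_derivative_at by (metis (no_types, lifting) ext)
qed

lemma bounded_frechet_derivative_bump:
  obtains C where "\<And>x. \<bar>frechet_derivative (bump n a b) (at x) h\<bar> \<le> C"
proof -
  have "compact ((\<lambda>x. frechet_derivative (bump n a b) (at x) h) ` cbox a b)"
    by (intro compact_continuous_image compact_cbox continuous_on_subset[OF frechet_derivative_test_function(2)[OF test_function_bump]]) auto
  then have "bounded ((\<lambda>x. frechet_derivative (bump n a b) (at x) h) ` cbox a b)"
    by (rule compact_imp_bounded)
  then obtain C where C: "\<And>x. x \<in> cbox a b \<Longrightarrow> \<bar>frechet_derivative (bump n a b) (at x) h\<bar> \<le> C"
    unfolding bounded_iff real_norm_def by blast
  \<comment> \<open>The maximum with 0 covers points outside the box, where the derivative is 0 and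
    \<open>C\<close> says nothing.\<close>
  have "\<bar>frechet_derivative (bump n a b) (at x) h\<bar> \<le> max C 0" for x
    using C[of x] frechet_derivative_bump_eq_0[of x a b n h] by (cases "x \<in> cbox a b") auto
  then show ?thesis by (rule that)
qed

lemma borel_measurable_bump [measurable]: "bump n a b \<in> borel_measurable borel"
proof -
  have "cont_diff 0 (bump n a b)"
    using test_function_bump unfolding test_function_def by blast
  then show ?thesis by (simp add: borel_measurable_continuous_onI)
qed

lemma abs_bump_le: "\<bar>bump n a b x\<bar> \<le> 1"
  using bump_bounds[of n a b x] by simp

lemma cbox_segment_bounds:
  fixes y h :: "'a::euclidean_space"
  assumes "y - \<tau> *\<^sub>R h \<in> cbox a b" "\<tau> \<in> {0..1}"
  shows "y \<in> cbox (a - norm h *\<^sub>R One) (b + norm h *\<^sub>R One)"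
  unfolding mem_box
proof
  fix i :: 'a assume i: "i \<in> Basis"
  have "\<bar>\<tau> * (h \<bullet> i)\<bar> \<le> 1 * norm h"
    unfolding abs_mult using assms(2) Basis_le_norm[OF i, of h] by (intro mult_mono) auto
  moreover have "a \<bullet> i \<le> y \<bullet> i - \<tau> * (h \<bullet> i)" "y \<bullet> i - \<tau> * (h \<bullet> i) \<le> b \<bullet> i"
    using assms(1) i by (auto simp: mem_box inner_simps)
  ultimately show "(a - norm h *\<^sub>R One) \<bullet> i \<le> y \<bullet> i \<and> y \<bullet> i \<le> (b + norm h *\<^sub>R One) \<bullet> i"
    using i by (auto simp: inner_simps abs_le_iff)
qed

text \<open>Borel representatives are required because f and g are composed with (y, tau) |-> y +
  tau h and then integrated by Fubini on a product.\<close>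

locale weak_gradient =
  fixes f :: "'a::euclidean_space \<Rightarrow> real" and g :: "'a \<Rightarrow> 'a"
  assumes f_meas [measurable]: "f \<in> borel_measurable borel"
    and g_meas [measurable]: "g \<in> borel_measurable borel"
    and f_int: "\<And>a b. set_integrable lborel (cbox a b) f"
    and g_int: "\<And>a b. set_integrable lborel (cbox a b) g"
    and weak: "\<And>\<phi> i. test_function UNIV \<phi> \<Longrightarrow> i \<in> Basis \<Longrightarrow>
      (\<integral>x. f x * frechet_derivative \<phi> (at x) i \<partial>lborel) = - (\<integral>x. (g x \<bullet> i) * \<phi> x \<partial>lborel)"
begin

lemma g_inner_int: "set_integrable lborel (cbox a b) (\<lambda>x. g x \<bullet> h)"
  using integrable_inner_left[OF g_int[of a b, unfolded set_integrable_def], of h] unfolding set_integrable_def by simp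

lemma nn_integral_g_finite: "(\<integral>\<^sup>+y\<in>cbox a b. ennreal (norm (g y)) \<partial>lborel) < top"
proof -
  have "(\<integral>\<^sup>+y\<in>cbox a b. ennreal (norm (g y)) \<partial>lborel) = (\<integral>\<^sup>+y. ennreal (norm (indicator (cbox a b) y *\<^sub>R g y)) \<partial>lborel)"
    by (intro nn_integral_cong) (auto simp: indicator_def)
  also have "\<dots> < top"
    using g_int[of a b] unfolding set_integrable_def integrable_iff_bounded by simp
  finally show ?thesis .
qed

text \<open>The hypothesis of Fubini's theorem. For y in the box and tau in [0, 1], the point y +
  tau h stays in the box enlarged by |h|, on which \<open>g\<close> is integrable.\<close>

lemma integrable_pair_segment_g:
  fixes \<psi> :: "'a \<Rightarrow> real"
  assumes [measurable]: "\<psi> \<in> borel_measurable borel"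
    and bound: "\<And>x. \<bar>\<psi> x\<bar> \<le> 1" and supp: "\<And>x. x \<notin> cbox a b \<Longrightarrow> \<psi> x = 0"
  shows "integrable (lborel \<Otimes>\<^sub>M lborel) (\<lambda>(y, \<tau>). \<psi> y * (indicator {0..1} \<tau> * (g (y + \<tau> *\<^sub>R h) \<bullet> h)))"
proof (rule integrableI_bounded)
  show "(\<lambda>(y, \<tau>). \<psi> y * (indicator {0..1} \<tau> * (g (y + \<tau> *\<^sub>R h) \<bullet> h))) \<in> borel_measurable (lborel \<Otimes>\<^sub>M lborel)"
    by measurable
  let ?K = "cbox (a - norm h *\<^sub>R One) (b + norm h *\<^sub>R One)"
  define J where "J = (\<integral>\<^sup>+y\<in>?K. ennreal (norm (g y)) \<partial>lborel)"
  have "(\<integral>\<^sup>+x. ennreal (norm (case x of (y, \<tau>) \<Rightarrow> \<psi> y * (indicator {0..1} \<tau> * (g (y + \<tau> *\<^sub>R h) \<bullet> h)))) \<partial>(lborel \<Otimes>\<^sub>M lborel))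
      = (\<integral>\<^sup>+\<tau>. (\<integral>\<^sup>+y. ennreal (norm (\<psi> y * (indicator {0..1} \<tau> * (g (y + \<tau> *\<^sub>R h) \<bullet> h)))) \<partial>lborel) \<partial>lborel)"
    by (subst lborel_pair.nn_integral_snd[symmetric]) auto
  also have "\<dots> \<le> (\<integral>\<^sup>+\<tau>. (ennreal (norm h) * J) * indicator {0..1} (\<tau>::real) \<partial>lborel)"
  proof (rule nn_integral_mono)
    fix \<tau> :: real
    show "(\<integral>\<^sup>+y. ennreal (norm (\<psi> y * (indicator {0..1} \<tau> * (g (y + \<tau> *\<^sub>R h) \<bullet> h)))) \<partial>lborel) \<le> (ennreal (norm h) * J) * indicator {0..1} \<tau>"
    proof (cases "\<tau> \<in> {0..1}")
      case True
      have "(\<integral>\<^sup>+y. ennreal (norm (\<psi> y * (indicator {0..1} \<tau> * (g (y + \<tau> *\<^sub>R h) \<bullet> h)))) \<partial>lborel)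
        \<le> (\<integral>\<^sup>+y. ennreal (norm h) * (ennreal (norm (g (y + \<tau> *\<^sub>R h))) * indicator ?K (y + \<tau> *\<^sub>R h)) \<partial>lborel)"
      proof (rule nn_integral_mono)
        fix y
        show "ennreal (norm (\<psi> y * (indicator {0..1} \<tau> * (g (y + \<tau> *\<^sub>R h) \<bullet> h))))
            \<le> ennreal (norm h) * (ennreal (norm (g (y + \<tau> *\<^sub>R h))) * indicator ?K (y + \<tau> *\<^sub>R h))"
        proof (cases "y \<in> cbox a b")
          case yin: True
          have "y + \<tau> *\<^sub>R h \<in> ?K"
            using cbox_segment_bounds[of "y + \<tau> *\<^sub>R h" \<tau> h a b] yin True by simp
          moreover have "\<bar>\<psi> y\<bar> * \<bar>g (y + \<tau> *\<^sub>R h) \<bullet> h\<bar> \<le> 1 * (norm h * norm (g (y + \<tau> *\<^sub>R h)))"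
            using bound[of y] Cauchy_Schwarz_ineq2[of "g (y + \<tau> *\<^sub>R h)" h]
            by (intro mult_mono) (auto simp: mult.commute)
          ultimately show ?thesis
            using True by (simp add: abs_mult ennreal_mult[symmetric])
        next
          case False
          then show ?thesis using supp by simp
        qed
      qed
      also have "\<dots> = (\<integral>\<^sup>+y. ennreal (norm h) * (ennreal (norm (g y)) * indicator ?K y) \<partial>lborel)"
        by (rule nn_integral_lborel_translate) measurable
      also have "\<dots> = ennreal (norm h) * J"
        unfolding J_def by (rule nn_integral_cmult) measurable
      finally show ?thesis using True by simp
    qed simp
  qed
  also have "\<dots> = ennreal (norm h) * J"
    by (subst nn_integral_cmult_indicator) auto
  also have "\<dots> < top"
    using nn_integral_g_finite by (simp add: J_def ennreal_mult_less_top)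
  finally show "(\<integral>\<^sup>+x. ennreal (norm (case x of (y, \<tau>) \<Rightarrow> \<psi> y * (indicator {0..1} \<tau> * (g (y + \<tau> *\<^sub>R h) \<bullet> h)))) \<partial>(lborel \<Otimes>\<^sub>M lborel)) < \<infinity>"
    by simp
qed

text \<open>The line integral of \<open>g\<close> along the segment from \<open>y\<close> to
  \<open>y + h\<close>. It is 0 by convention where the integrand is not integrable.\<close>

definition seg :: "'a \<Rightarrow> 'a \<Rightarrow> real" where
  "seg h y = (\<integral>\<tau>. indicator {0..1} \<tau> * (g (y + \<tau> *\<^sub>R h) \<bullet> h) \<partial>lborel)"

lemma measurable_seg [measurable]: "seg h \<in> borel_measurable borel"
  unfolding seg_def[abs_def] by measurable

lemma seg_mult_integral:
  fixes \<psi> :: "'a \<Rightarrow> real"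
  assumes "\<psi> \<in> borel_measurable borel"
    and "\<And>x. \<bar>\<psi> x\<bar> \<le> 1" and "\<And>x. x \<notin> cbox a b \<Longrightarrow> \<psi> x = 0"
  shows "integrable lborel (\<lambda>y. seg h y * \<psi> y)"
    and "(\<integral>y. seg h y * \<psi> y \<partial>lborel) = (\<integral>\<tau>. indicator {0..1} \<tau> * (\<integral>y. (g (y + \<tau> *\<^sub>R h) \<bullet> h) * \<psi> y \<partial>lborel) \<partial>lborel)"
proof -
  note int = integrable_pair_segment_g[where h=h, OF assms]
  have eq: "(\<integral>\<tau>. \<psi> y * (indicator {0..1} \<tau> * (g (y + \<tau> *\<^sub>R h) \<bullet> h)) \<partial>lborel) = seg h y * \<psi> y" for y
    unfolding seg_def by (simp add: mult.commute)
  show "integrable lborel (\<lambda>y. seg h y * \<psi> y)"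
    using lborel_pair.integrable_fst[OF int] unfolding eq .
  have "(\<integral>y. seg h y * \<psi> y \<partial>lborel) = (\<integral>\<tau>. (\<integral>y. \<psi> y * (indicator {0..1} \<tau> * (g (y + \<tau> *\<^sub>R h) \<bullet> h)) \<partial>lborel) \<partial>lborel)"
    unfolding eq[symmetric] by (rule lborel_pair.Fubini_integral[symmetric]) (rule int)
  also have "\<dots> = (\<integral>\<tau>. indicator {0..1} \<tau> * (\<integral>y. (g (y + \<tau> *\<^sub>R h) \<bullet> h) * \<psi> y \<partial>lborel) \<partial>lborel)"
    by (intro Bochner_Integration.integral_cong refl) (simp add: mult_ac flip: integral_mult_right_zero)
  finally show "(\<integral>y. seg h y * \<psi> y \<partial>lborel) = (\<integral>\<tau>. indicator {0..1} \<tau> * (\<integral>y. (g (y + \<tau> *\<^sub>R h) \<bullet> h) * \<psi> y \<partial>lborel) \<partial>lborel)" .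
qed

text \<open>Shifting the bump by tau h gives the bump of a shifted box, again a test function; the
  direction \<open>h\<close> is resolved into coordinates to apply the weak gradient.\<close>

lemma weak_directional:
  "(\<integral>y. f y * frechet_derivative (bump n a b) (at (y - \<tau> *\<^sub>R h)) h \<partial>lborel)
    = - (\<integral>y. (g (y + \<tau> *\<^sub>R h) \<bullet> h) * bump n a b y \<partial>lborel)"
proof -
  let ?a = "a + \<tau> *\<^sub>R h" and ?b = "b + \<tau> *\<^sub>R h"
  let ?\<phi> = "bump n ?a ?b"
  have [measurable]: "(\<lambda>y. frechet_derivative ?\<phi> (at y) i) \<in> borel_measurable borel" for i
    by (rule borel_measurable_continuous_onI[OF frechet_derivative_test_function(2)[OF test_function_bump]])
  have int: "integrable lborel (\<lambda>y. f y * frechet_derivative ?\<phi> (at y) i)" for i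
  proof -
    obtain C where "\<And>x. \<bar>frechet_derivative ?\<phi> (at x) i\<bar> \<le> C"
      using bounded_frechet_derivative_bump by blast
    then show ?thesis
      by (intro integrable_mult_compact_support[OF _ _ f_int[of ?a ?b]]) (auto simp: frechet_derivative_bump_eq_0)
  qed
  have int_g: "integrable lborel (\<lambda>y. (g y \<bullet> i) * ?\<phi> y)" for i
    by (intro integrable_mult_compact_support[OF _ _ g_inner_int[of ?a ?b]]) (auto simp: bump_eq_0' intro: abs_bump_le)
  have "(\<integral>y. f y * frechet_derivative (bump n a b) (at (y - \<tau> *\<^sub>R h)) h \<partial>lborel)
      = (\<integral>y. (\<Sum>i\<in>Basis. (h \<bullet> i) * (f y * frechet_derivative ?\<phi> (at y) i)) \<partial>lborel)"
    unfolding frechet_derivative_bump_translate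
    by (intro Bochner_Integration.integral_cong refl, subst frechet_derivative_test_function(3)[OF test_function_bump])
      (simp add: sum_distrib_left mult_ac)
  also have "\<dots> = (\<Sum>i\<in>Basis. (h \<bullet> i) * (\<integral>y. f y * frechet_derivative ?\<phi> (at y) i \<partial>lborel))"
    using int by (simp add: Bochner_Integration.integral_sum)
  also have "\<dots> = - (\<Sum>i\<in>Basis. (h \<bullet> i) * (\<integral>y. (g y \<bullet> i) * ?\<phi> y \<partial>lborel))"
    by (simp add: weak[OF test_function_bump] sum_negf)
  also have "(\<Sum>i\<in>Basis. (h \<bullet> i) * (\<integral>y. (g y \<bullet> i) * ?\<phi> y \<partial>lborel)) = (\<integral>y. (\<Sum>i\<in>Basis. (h \<bullet> i) * ((g y \<bullet> i) * ?\<phi> y)) \<partial>lborel)"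
    using int_g by (simp add: Bochner_Integration.integral_sum)
  also have "\<dots> = (\<integral>y. (g y \<bullet> h) * ?\<phi> y \<partial>lborel)"
    by (intro Bochner_Integration.integral_cong refl, subst euclidean_inner[of _ h])
      (simp add: sum_distrib_left sum_distrib_right mult_ac)
  also have "\<dots> = (\<integral>y. (g (y + \<tau> *\<^sub>R h) \<bullet> h) * ?\<phi> (y + \<tau> *\<^sub>R h) \<partial>lborel)"
    by (rule integral_lborel_translate[symmetric]) measurable
  also have "\<dots> = (\<integral>y. (g (y + \<tau> *\<^sub>R h) \<bullet> h) * bump n a b y \<partial>lborel)"
    unfolding bump_translate[symmetric] by simp
  finally show ?thesis .
qed

text \<open>The fundamental theorem of calculus for the bump along tau |-> y - tau h; the sign comes
  from the chain rule.\<close>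

lemma bump_shift_diff:
  "bump n a b (y - h) - bump n a b y
    = - (\<integral>\<tau>. indicator {0..1} \<tau> * frechet_derivative (bump n a b) (at (y - \<tau> *\<^sub>R h)) h \<partial>lborel)"
proof -
  let ?D = "\<lambda>\<tau>. frechet_derivative (bump n a b) (at (y - \<tau> *\<^sub>R h)) h"
  have "((\<lambda>\<tau>. bump n a b (y - \<tau> *\<^sub>R h)) has_real_derivative - ?D \<tau>) (at \<tau>)" for \<tau>
  proof -
    have "((\<lambda>\<tau>. y - \<tau> *\<^sub>R h) has_derivative (\<lambda>s. - s *\<^sub>R h)) (at \<tau>)"
      by (auto intro!: derivative_eq_intros)
    from has_derivative_compose[OF this frechet_derivative_test_function(1)[OF test_function_bump]]
    have "((\<lambda>\<tau>. bump n a b (y - \<tau> *\<^sub>R h)) has_derivative (\<lambda>s. frechet_derivative (bump n a b) (at (y - \<tau> *\<^sub>R h)) (- s *\<^sub>R h))) (at \<tau>)" .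
    moreover have "linear (frechet_derivative (bump n a b) (at (y - \<tau> *\<^sub>R h)))"
      using frechet_derivative_test_function(1)[OF test_function_bump] has_derivative_linear by blast
    then have "(\<lambda>s. frechet_derivative (bump n a b) (at (y - \<tau> *\<^sub>R h)) (- s *\<^sub>R h)) = (*) (- ?D \<tau>)"
      by (auto simp: linear_scale linear_neg fun_eq_iff)
    ultimately show ?thesis by (simp add: has_field_derivative_def)
  qed
  moreover have "isCont (\<lambda>\<tau>. - ?D \<tau>) \<tau>" for \<tau>
  proof -
    have "continuous_on UNIV (\<lambda>\<tau>. ?D \<tau>)"
      by (rule continuous_on_compose2[OF frechet_derivative_test_function(2)[OF test_function_bump]])
        (auto intro!: continuous_intros)
    then show ?thesis by (simp add: continuous_on_eq_continuous_at)
  qed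
  ultimately have "(\<integral>\<tau>. - ?D \<tau> * indicator {0..1} \<tau> \<partial>lborel) = bump n a b (y - 1 *\<^sub>R h) - bump n a b (y - 0 *\<^sub>R h)"
    by (intro integral_FTC_Icc_real) auto
  then show ?thesis by (simp add: mult.commute)
qed

text \<open>The shift is moved from \<open>f\<close> to the bump and written as an integral over
  tau. After Fubini the weak gradient is applied for each tau separately.\<close>

lemma integral_shift_diff_bump:
  "(\<integral>y. f (y + h) * bump n a b y \<partial>lborel) - (\<integral>y. f y * bump n a b y \<partial>lborel) = (\<integral>y. seg h y * bump n a b y \<partial>lborel)"
proof -
  let ?\<phi> = "bump n a b"
  let ?D = "\<lambda>y. frechet_derivative ?\<phi> (at y) h"
  let ?K = "cbox (a - norm h *\<^sub>R One) (b + norm h *\<^sub>R One)"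
  have [measurable]: "?D \<in> borel_measurable borel"
    by (rule borel_measurable_continuous_onI[OF frechet_derivative_test_function(2)[OF test_function_bump]])
  obtain C where C: "\<And>x. \<bar>?D x\<bar> \<le> C"
    using bounded_frechet_derivative_bump by blast
  have C0: "0 \<le> C" using C[of 0] by linarith
  have int0: "integrable lborel (\<lambda>y. f y * ?\<phi> y)"
    by (intro integrable_mult_compact_support[OF _ _ f_int[of a b]]) (auto simp: bump_eq_0' intro: abs_bump_le)
  have int1: "integrable lborel (\<lambda>y. f y * ?\<phi> (y - h))"
    unfolding bump_translate
    by (intro integrable_mult_compact_support[OF _ _ f_int[of "a + h" "b + h"]]) (auto simp: bump_eq_0' intro: abs_bump_le)
  have intf: "integrable lborel (\<lambda>y. \<bar>f y\<bar> * indicator ?K y)"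
  proof -
    have "integrable lborel (\<lambda>y. norm (indicator ?K y *\<^sub>R f y))"
      using f_int[unfolded set_integrable_def] by (rule integrable_norm)
    also have "(\<lambda>y. norm (indicator ?K y *\<^sub>R f y)) = (\<lambda>y. \<bar>f y\<bar> * indicator ?K y)"
      by (auto simp: fun_eq_iff indicator_def)
    finally show ?thesis .
  qed
  \<comment> \<open>Fubini is justified by the bound C |f| on the enlarged box
    \<open>?K\<close>.\<close>
  have int2: "integrable (lborel \<Otimes>\<^sub>M lborel) (\<lambda>(y, \<tau>). indicator {0..1::real} \<tau> * (f y * ?D (y - \<tau> *\<^sub>R h)))"
  proof (rule integrableI_bounded)
    show "(\<lambda>(y, \<tau>). indicator {0..1::real} \<tau> * (f y * ?D (y - \<tau> *\<^sub>R h))) \<in> borel_measurable (lborel \<Otimes>\<^sub>M lborel)"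
      by measurable
    have "(\<integral>\<^sup>+x. ennreal (norm (case x of (y, \<tau>) \<Rightarrow> indicator {0..1::real} \<tau> * (f y * ?D (y - \<tau> *\<^sub>R h)))) \<partial>(lborel \<Otimes>\<^sub>M lborel))
      \<le> (\<integral>\<^sup>+x. (case x of (y, \<tau>) \<Rightarrow> ennreal (C * (\<bar>f y\<bar> * indicator ?K y)) * indicator {0..1::real} \<tau>) \<partial>(lborel \<Otimes>\<^sub>M lborel))"
    proof (rule nn_integral_mono, clarify)
      fix y :: 'a and \<tau> :: real
      show "ennreal (norm (indicator {0..1::real} \<tau> * (f y * ?D (y - \<tau> *\<^sub>R h)))) \<le> ennreal (C * (\<bar>f y\<bar> * indicator ?K y)) * indicator {0..1::real} \<tau>"
      proof (cases "\<tau> \<in> {0..1}")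
        case True
        have "\<bar>f y * ?D (y - \<tau> *\<^sub>R h)\<bar> \<le> C * (\<bar>f y\<bar> * indicator ?K y)"
        proof (cases "y - \<tau> *\<^sub>R h \<in> cbox a b")
          case yin: True
          then have "y \<in> ?K" using cbox_segment_bounds True by blast
          then show ?thesis
            using mult_left_mono[OF C[of "y - \<tau> *\<^sub>R h"], of "\<bar>f y\<bar>"] by (simp add: abs_mult mult.commute[of C])
        next
          case False
          then show ?thesis using C0 by (simp add: frechet_derivative_bump_eq_0)
        qed
        then show ?thesis using True by (simp add: ennreal_leI)
      qed simp
    qed
    also have "\<dots> = (\<integral>\<^sup>+y. (\<integral>\<^sup>+\<tau>. ennreal (C * (\<bar>f y\<bar> * indicator ?K y)) * indicator {0..1::real} \<tau> \<partial>lborel) \<partial>lborel)"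
      by (subst lborel.nn_integral_fst[symmetric]) auto
    also have "\<dots> = (\<integral>\<^sup>+y. ennreal (C * (\<bar>f y\<bar> * indicator ?K y)) \<partial>lborel)"
      by (subst nn_integral_cmult_indicator) auto
    also have "\<dots> = ennreal C * (\<integral>\<^sup>+y. ennreal (\<bar>f y\<bar> * indicator ?K y) \<partial>lborel)"
      using C0 by (simp add: ennreal_mult' nn_integral_cmult)
    also have "\<dots> < \<infinity>"
      using intf by (auto simp: integrable_iff_bounded abs_mult ennreal_mult_less_top)
    finally show "(\<integral>\<^sup>+x. ennreal (norm (case x of (y, \<tau>) \<Rightarrow> indicator {0..1::real} \<tau> * (f y * ?D (y - \<tau> *\<^sub>R h)))) \<partial>(lborel \<Otimes>\<^sub>M lborel)) < \<infinity>" .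
  qed
  have "(\<integral>y. f (y + h) * ?\<phi> y \<partial>lborel) = (\<integral>y. f y * ?\<phi> (y - h) \<partial>lborel)"
    using integral_lborel_translate[of "\<lambda>y. f y * ?\<phi> (y - h)" h] by simp
  then have "(\<integral>y. f (y + h) * ?\<phi> y \<partial>lborel) - (\<integral>y. f y * ?\<phi> y \<partial>lborel) = (\<integral>y. f y * (?\<phi> (y - h) - ?\<phi> y) \<partial>lborel)"
    using int0 int1 by (simp add: right_diff_distrib)
  also have "\<dots> = - (\<integral>y. (\<integral>\<tau>. indicator {0..1::real} \<tau> * (f y * ?D (y - \<tau> *\<^sub>R h)) \<partial>lborel) \<partial>lborel)"
  proof -
    have "f y * (?\<phi> (y - h) - ?\<phi> y) = - (\<integral>\<tau>. indicator {0..1::real} \<tau> * (f y * ?D (y - \<tau> *\<^sub>R h)) \<partial>lborel)" for y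
      unfolding bump_shift_diff by (simp add: mult.left_commute flip: integral_mult_right_zero)
    then show ?thesis by (simp only: Bochner_Integration.integral_minus)
  qed
  also have "(\<integral>y. (\<integral>\<tau>. indicator {0..1::real} \<tau> * (f y * ?D (y - \<tau> *\<^sub>R h)) \<partial>lborel) \<partial>lborel)
      = (\<integral>\<tau>. (\<integral>y. indicator {0..1::real} \<tau> * (f y * ?D (y - \<tau> *\<^sub>R h)) \<partial>lborel) \<partial>lborel)"
    by (rule lborel_pair.Fubini_integral[symmetric]) (rule int2)
  also have "\<dots> = - (\<integral>\<tau>. indicator {0..1::real} \<tau> * (\<integral>y. (g (y + \<tau> *\<^sub>R h) \<bullet> h) * ?\<phi> y \<partial>lborel) \<partial>lborel)"
    by (simp add: weak_directional)
  also have "\<dots> = - (\<integral>y. seg h y * ?\<phi> y \<partial>lborel)"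
    by (subst seg_mult_integral(2)[where a=a and b=b]) (auto simp: bump_eq_0' intro: abs_bump_le)
  finally show ?thesis by simp
qed

end

section \<open>The difference formula almost everywhere and Poincare's inequality\<close>

lemma integrable_lborel_translate:
  fixes F :: "'a::euclidean_space \<Rightarrow> real"
  assumes [measurable]: "F \<in> borel_measurable borel" and "integrable lborel F"
  shows "integrable lborel (\<lambda>x. F (x + h))"
proof -
  have "integrable (distr lborel borel ((+) h)) F"
    using assms(2) by (simp only: lborel_distr_plus)
  then have "integrable lborel (\<lambda>x. F (h + x))"
    by (subst (asm) integrable_distr_eq) auto
  then show ?thesis by (simp add: add.commute)
qed

context weak_gradient
begin

text \<open>The difference of both sides integrates to zero against every bump, hence over every box,
  so Lebesgue's differentiation theorem shows that it vanishes almost everywhere.\<close>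

lemma AE_shift_diff: "AE y in lborel. f (y + h) - f y = seg h y"
proof -
  define w where "w y = f (y + h) - f y - seg h y" for y
  have w_meas [measurable]: "w \<in> borel_measurable borel"
    unfolding w_def[abs_def] by measurable
  \<comment> \<open>A general \<open>\<psi>\<close> covers both the bumps and the indicators of
    closed boxes.\<close>
  have ints: "integrable lborel (\<lambda>y. f (y + h) * \<psi> y)" "integrable lborel (\<lambda>y. f y * \<psi> y)" "integrable lborel (\<lambda>y. seg h y * \<psi> y)"
    if [measurable]: "\<psi> \<in> borel_measurable borel" and b: "\<And>x. \<bar>\<psi> x\<bar> \<le> 1" "\<And>x. x \<notin> cbox a b \<Longrightarrow> \<psi> x = 0"
    for \<psi> a b
  proof -
    show "integrable lborel (\<lambda>y. f y * \<psi> y)"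
      by (rule integrable_mult_compact_support[OF _ _ f_int[of a b] b]) auto
    show "integrable lborel (\<lambda>y. seg h y * \<psi> y)"
      by (rule seg_mult_integral[OF _ b]) auto
    have "x - h \<in> cbox a b \<longleftrightarrow> x \<in> cbox (a + h) (b + h)" for x
      by (auto simp: mem_box inner_simps algebra_simps)
    then have "integrable lborel (\<lambda>y. f y * \<psi> (y - h))"
      by (intro integrable_mult_compact_support[where C=1, OF _ _ f_int[of "a + h" "b + h"]]) (auto simp: b)
    from integrable_lborel_translate[OF _ this, of h]
    show "integrable lborel (\<lambda>y. f (y + h) * \<psi> y)" by simp
  qed
  have w_ints: "integrable lborel (\<lambda>y. w y * \<psi> y)"
    and w_eq: "(\<integral>y. w y * \<psi> y \<partial>lborel) = (\<integral>y. f (y + h) * \<psi> y \<partial>lborel) - (\<integral>y. f y * \<psi> y \<partial>lborel) - (\<integral>y. seg h y * \<psi> y \<partial>lborel)"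
    if "\<psi> \<in> borel_measurable borel" "\<And>x. \<bar>\<psi> x\<bar> \<le> 1" "\<And>x. x \<notin> cbox a b \<Longrightarrow> \<psi> x = 0" for \<psi> a b
    using ints[OF that] unfolding w_def by (simp_all add: left_diff_distrib)
  have w_bump: "(\<integral>y. w y * bump n a b y \<partial>lborel) = 0" for n a b
    using w_eq[of "bump n a b" a b] integral_shift_diff_bump[of h n a b]
    by (simp add: bump_eq_0' abs_bump_le)
  have w_ind: "integrable lborel (\<lambda>y. w y * indicator (cbox a b) y)" for a b
    by (rule w_ints[of _ a b]) (auto simp: indicator_def)
  then have w_int: "set_integrable lborel (cbox a b) w" for a b
    unfolding set_integrable_def by (simp add: mult.commute)
  \<comment> \<open>All bumps are at most 1 and vanish off the closed box, so |w| on that box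
    dominates the sequence.\<close>
  have w_box: "(\<integral>y. w y * indicator (box a b) y \<partial>lborel) = 0" for a b
  proof -
    have "(\<lambda>n. \<integral>y. w y * bump n a b y \<partial>lborel) \<longlonglongrightarrow> (\<integral>y. w y * indicator (box a b) y \<partial>lborel)"
    proof (rule integral_dominated_convergence[where w="\<lambda>y. norm (w y * indicator (cbox a b) y)"])
      show "AE y in lborel. norm (w y * bump n a b y) \<le> norm (w y * indicator (cbox a b) y)" for n
        using abs_bump_le[of n a b] bump_eq_0'[of _ a b n]
        by (intro AE_I2) (auto simp: abs_mult indicator_def mult_left_le)
      show "AE y in lborel. (\<lambda>n. w y * bump n a b y) \<longlonglongrightarrow> w y * indicator (box a b) y"
        by (intro AE_I2 tendsto_mult tendsto_const bump_tendsto)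
      show "integrable lborel (\<lambda>y. norm (w y * indicator (cbox a b) y))"
        using w_ind by (rule integrable_norm)
    qed auto
    then show ?thesis unfolding w_bump using LIMSEQ_unique tendsto_const by blast
  qed
  have zero: "cube_mean w t x = 0" if t: "0 < t" for t x
  proof -
    let ?b = "x + t *\<^sub>R One"
    \<comment> \<open>The bumps converge to the indicator of the open box, whereas
      \<open>cube_mean\<close> uses the closed one; the integrals agree.\<close>
    have "set_integrable lborel (box x ?b) w"
      by (rule set_integrable_subset[OF w_int[of x ?b]]) (auto simp: box_subset_cbox)
    from set_borel_integral_eq_integral(2)[OF this]
    have "integral (box x ?b) w = 0"
      using w_box[of x ?b] by (simp add: set_lebesgue_integral_def mult.commute)
    then have "integral (cbox x ?b) w = 0"
      by (simp add: integral_open_interval)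
    then show ?thesis
      using cube_mean_eq_integral[OF w_meas w_int t, of x] t by simp
  qed
  have "AE x in lborel. \<forall>t>0. (\<lambda>n. cube_mean w (t / 2 ^ n) x) \<longlonglongrightarrow> w x"
    by (rule AE_cube_mean_tendsto[OF w_meas w_int])
  then show ?thesis
  proof eventually_elim
    case (elim x)
    then have "(\<lambda>n. cube_mean w (1 / 2 ^ n) x) \<longlonglongrightarrow> w x" by simp
    then have "w x = 0"
      using LIMSEQ_unique[OF _ tendsto_const[of 0]] by (simp add: zero)
    then show ?case by (simp add: w_def)
  qed
qed

text \<open>Cauchy-Schwarz under the integral; if the integrand is not integrable,
  \<open>seg h y\<close> is 0 by convention.\<close>

lemma seg_le: "ennreal \<bar>seg h y\<bar> \<le> (\<integral>\<^sup>+\<tau>\<in>{0..1}. ennreal (norm h) * ennreal (norm (g (y + \<tau> *\<^sub>R h))) \<partial>lborel)"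
proof (cases "integrable lborel (\<lambda>\<tau>. indicator {0..1} \<tau> * (g (y + \<tau> *\<^sub>R h) \<bullet> h))")
  case True
  then have "ennreal \<bar>seg h y\<bar> \<le> (\<integral>\<^sup>+\<tau>. ennreal (norm (indicator {0..1} \<tau> * (g (y + \<tau> *\<^sub>R h) \<bullet> h))) \<partial>lborel)"
    unfolding seg_def real_norm_def[symmetric] by (rule integral_norm_bound_ennreal)
  also have "\<dots> \<le> (\<integral>\<^sup>+\<tau>\<in>{0..1}. ennreal (norm h) * ennreal (norm (g (y + \<tau> *\<^sub>R h))) \<partial>lborel)"
    using Cauchy_Schwarz_ineq2[of "g _" h]
    by (intro nn_integral_mono) (auto simp: indicator_def ennreal_mult[symmetric] mult.commute intro!: ennreal_leI)
  finally show ?thesis .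
next
  case False
  then show ?thesis by (simp add: seg_def not_integrable_integral_eq)
qed

text \<open>A box is convex, so the segment between two of its points meets only values of
  \<open>g\<close> inside it. For each tau, translation by tau h then restores the integral over the
  box.\<close>

lemma nn_integral_shift_diff_le:
  "(\<integral>\<^sup>+y. ennreal \<bar>f (y + h) - f y\<bar> * indicator (cbox a b) y * indicator (cbox a b) (y + h) \<partial>lborel)
    \<le> ennreal (norm h) * (\<integral>\<^sup>+y\<in>cbox a b. ennreal (norm (g y)) \<partial>lborel)"
proof -
  let ?Q = "cbox a b"
  have "(\<integral>\<^sup>+y. ennreal \<bar>f (y + h) - f y\<bar> * indicator ?Q y * indicator ?Q (y + h) \<partial>lborel)
    \<le> (\<integral>\<^sup>+y. (\<integral>\<^sup>+\<tau>\<in>{0..1}. ennreal (norm h) * (ennreal (norm (g (y + \<tau> *\<^sub>R h))) * indicator ?Q (y + \<tau> *\<^sub>R h)) \<partial>lborel) \<partial>lborel)"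
  proof (rule nn_integral_mono_AE, use AE_shift_diff[of h] in eventually_elim)
    case (elim y)
    show ?case
    proof (cases "y \<in> ?Q \<and> y + h \<in> ?Q")
      case True
      have "y + \<tau> *\<^sub>R h \<in> ?Q" if "\<tau> \<in> {0..1}" for \<tau>
      proof -
        have "(1 - \<tau>) *\<^sub>R y + \<tau> *\<^sub>R (y + h) \<in> ?Q"
          using True that by (intro convexD_alt[OF convex_box(1)]) auto
        then show ?thesis by (simp add: algebra_simps)
      qed
      then have "(\<integral>\<^sup>+\<tau>\<in>{0..1}. ennreal (norm h) * ennreal (norm (g (y + \<tau> *\<^sub>R h))) \<partial>lborel)
        = (\<integral>\<^sup>+\<tau>\<in>{0..1}. ennreal (norm h) * (ennreal (norm (g (y + \<tau> *\<^sub>R h))) * indicator ?Q (y + \<tau> *\<^sub>R h)) \<partial>lborel)"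
        by (intro nn_integral_cong) (auto simp: indicator_def)
      with seg_le[of h y] elim True show ?thesis by simp
    qed auto
  qed
  also have "\<dots> = (\<integral>\<^sup>+\<tau>\<in>{0..1::real}. (\<integral>\<^sup>+y. ennreal (norm h) * (ennreal (norm (g (y + \<tau> *\<^sub>R h))) * indicator ?Q (y + \<tau> *\<^sub>R h)) \<partial>lborel) \<partial>lborel)"
    by (subst lborel_pair.Fubini') (auto simp: nn_integral_multc)
  also have "\<dots> = (\<integral>\<^sup>+\<tau>\<in>{0..1::real}. (\<integral>\<^sup>+y. ennreal (norm h) * (ennreal (norm (g y)) * indicator ?Q y) \<partial>lborel) \<partial>lborel)"
    by (subst nn_integral_lborel_translate[where f="\<lambda>y. ennreal (norm h) * (ennreal (norm (g y)) * indicator ?Q y)"]) auto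
  also have "\<dots> = ennreal (norm h) * (\<integral>\<^sup>+y\<in>?Q. ennreal (norm (g y)) \<partial>lborel)"
    by (subst nn_integral_cmult_indicator) (auto simp: nn_integral_cmult)
  finally show ?thesis .
qed

text \<open>In the double integral over the cube set z = y + h. Then h ranges over a cube of volume
  (2 t)^N, and |h| <= N t there; the constant is the product of 2^N and N.\<close>

theorem cube_poincare:
  assumes t: "0 < t"
  shows "cube_osc f t x \<le> ennreal (2 ^ DIM('a) * real DIM('a)) * (\<integral>\<^sup>+a. ennreal (t * norm (g (x + t *\<^sub>R a))) \<partial>unit_cube)"
proof -
  let ?N = "DIM('a)"
  let ?Q = "cbox x (x + t *\<^sub>R One)"
  let ?H = "cbox (- (t *\<^sub>R One)) (t *\<^sub>R One :: 'a)"
  define T where "T = ennreal (t ^ ?N)"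
  define A where "A = (\<integral>\<^sup>+a. ennreal (norm (g (x + t *\<^sub>R a))) \<partial>unit_cube)"
  define J where "J = (\<integral>\<^sup>+y\<in>?Q. ennreal (norm (g y)) \<partial>lborel)"
  have J: "J = T * A"
    unfolding J_def T_def A_def using t by (intro nn_integral_unit_cube_affine[symmetric]) auto
  have "T * (T * cube_osc f t x) = (\<integral>\<^sup>+y\<in>?Q. (\<integral>\<^sup>+z\<in>?Q. ennreal \<bar>f y - f z\<bar> \<partial>lborel) \<partial>lborel)"
    unfolding T_def using t by (intro cube_osc_eq_nn_integral) auto
  also have "\<dots> = (\<integral>\<^sup>+y. (\<integral>\<^sup>+h. ennreal \<bar>f (y + h) - f y\<bar> * indicator ?Q y * indicator ?Q (y + h) \<partial>lborel) \<partial>lborel)"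
  proof (rule nn_integral_cong)
    fix y :: 'a
    have e: "(\<integral>\<^sup>+z\<in>?Q. ennreal \<bar>f y - f z\<bar> \<partial>lborel) = (\<integral>\<^sup>+h. ennreal \<bar>f y - f (h + y)\<bar> * indicator ?Q (h + y) \<partial>lborel)"
      by (rule nn_integral_lborel_translate[symmetric]) measurable
    have "(\<integral>\<^sup>+z\<in>?Q. ennreal \<bar>f y - f z\<bar> \<partial>lborel) * indicator ?Q y = (\<integral>\<^sup>+h. ennreal \<bar>f y - f (h + y)\<bar> * indicator ?Q (h + y) * indicator ?Q y \<partial>lborel)"
      unfolding e by (rule nn_integral_multc[symmetric]) measurable
    also have "\<dots> = (\<integral>\<^sup>+h. ennreal \<bar>f (y + h) - f y\<bar> * indicator ?Q y * indicator ?Q (y + h) \<partial>lborel)"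
    proof (rule nn_integral_cong)
      fix h :: 'a
      have 1: "h + y = y + h" by (rule add.commute)
      have 2: "\<bar>f y - f (y + h)\<bar> = \<bar>f (y + h) - f y\<bar>" by (rule abs_minus_commute)
      show "ennreal \<bar>f y - f (h + y)\<bar> * indicator ?Q (h + y) * indicator ?Q y
          = ennreal \<bar>f (y + h) - f y\<bar> * indicator ?Q y * indicator ?Q (y + h)"
        unfolding 1 2 by (simp only: mult.assoc mult.commute mult.left_commute)
    qed
    finally show "(\<integral>\<^sup>+z\<in>?Q. ennreal \<bar>f y - f z\<bar> \<partial>lborel) * indicator ?Q y = \<dots>" .
  qed
  also have "\<dots> = (\<integral>\<^sup>+h. (\<integral>\<^sup>+y. ennreal \<bar>f (y + h) - f y\<bar> * indicator ?Q y * indicator ?Q (y + h) \<partial>lborel) \<partial>lborel)"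
    by (rule lborel_pair.Fubini') measurable
  also have "\<dots> \<le> (\<integral>\<^sup>+h. (ennreal (real ?N * t) * J) * indicator ?H h \<partial>lborel)"
  proof (rule nn_integral_mono)
    fix h :: 'a
    show "(\<integral>\<^sup>+y. ennreal \<bar>f (y + h) - f y\<bar> * indicator ?Q y * indicator ?Q (y + h) \<partial>lborel) \<le> (ennreal (real ?N * t) * J) * indicator ?H h"
    proof (cases "h \<in> ?H")
      case True
      have "norm h \<le> (\<Sum>i\<in>Basis. \<bar>h \<bullet> i\<bar>)" by (rule norm_le_l1)
      also have "\<dots> \<le> (\<Sum>i\<in>(Basis::'a set). t)"
      proof (rule sum_mono)
        fix i :: 'a assume "i \<in> Basis"
        with True have "- t \<le> h \<bullet> i \<and> h \<bullet> i \<le> t" by (simp add: mem_box)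
        then show "\<bar>h \<bullet> i\<bar> \<le> t" by linarith
      qed
      finally have "norm h \<le> real ?N * t" by simp
      then have "ennreal (norm h) * J \<le> ennreal (real ?N * t) * J"
        by (intro mult_right_mono ennreal_leI) auto
      then show ?thesis
        using nn_integral_shift_diff_le[of h x "x + t *\<^sub>R One"] True by (simp add: J_def)
    next
      case False
      then obtain i where i: "i \<in> Basis" "\<not> (- t \<le> h \<bullet> i \<and> h \<bullet> i \<le> t)"
        by (auto simp: mem_box)
      have "\<not> (y \<in> ?Q \<and> y + h \<in> ?Q)" for y
        using i by (force simp: mem_cube_iff inner_simps)
      then have "(\<integral>\<^sup>+y. ennreal \<bar>f (y + h) - f y\<bar> * indicator ?Q y * indicator ?Q (y + h) \<partial>lborel) = (\<integral>\<^sup>+y. 0 \<partial>(lborel :: 'a measure))"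
        by (intro nn_integral_cong) (auto simp: indicator_def)
      then show ?thesis by simp
    qed
  qed
  also have "\<dots> = ennreal (real ?N * t) * J * ennreal ((2 * t) ^ ?N)"
    using t by (subst nn_integral_cmult_indicator) (auto simp: emeasure_lborel_cbox_eq inner_simps)
  also have "\<dots> = T * (T * (ennreal (2 ^ ?N * real ?N) * (ennreal t * A)))"
    unfolding J T_def using t by (simp add: power_mult_distrib ennreal_mult' mult_ac)
  finally have "cube_osc f t x \<le> ennreal (2 ^ ?N * real ?N) * (ennreal t * A)"
    using t by (simp add: T_def ennreal_mult_le_mult_iff)
  also have "ennreal t * A = (\<integral>\<^sup>+a. ennreal (t * norm (g (x + t *\<^sub>R a))) \<partial>unit_cube)"
    unfolding A_def using t by (simp add: ennreal_mult' nn_integral_cmult)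
  finally show ?thesis .
qed

end

section \<open>Passage to Borel representatives and conclusion\<close>

lemma ex_borel_representative:
  fixes g :: "'a::euclidean_space \<Rightarrow> 'b::euclidean_space"
  assumes "g \<in> borel_measurable lebesgue"
  shows "\<exists>g'\<in>borel_measurable borel. AE x in lborel. g x = g' x"
proof -
  have "\<exists>h. h \<in> borel_measurable lborel \<and> (AE x in lborel. g x \<bullet> i = h x)" for i
  proof -
    have "(\<lambda>x. g x \<bullet> i) \<in> borel_measurable lebesgue"
      using assms by measurable
    from completion_ex_borel_measurable_real[OF this] show ?thesis by auto
  qed
  then obtain h where h: "\<And>i. h i \<in> borel_measurable lborel" "\<And>i. AE x in lborel. g x \<bullet> i = h i x"
    by metis
  have "AE x in lborel. \<forall>i\<in>Basis. g x \<bullet> i = h i x"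
    using h(2) by (subst AE_ball_countable) (auto intro: countable_finite)
  then have "AE x in lborel. g x = (\<Sum>i\<in>Basis. h i x *\<^sub>R i)"
  proof eventually_elim
    case (elim x)
    then have "(\<Sum>i\<in>Basis. h i x *\<^sub>R i) = (\<Sum>i\<in>Basis. (g x \<bullet> i) *\<^sub>R i)"
      by (intro sum.cong) auto
    then show ?case by (simp add: euclidean_representation)
  qed
  moreover have "(\<lambda>x. \<Sum>i\<in>Basis. h i x *\<^sub>R i) \<in> borel_measurable borel"
    using h(1) by (intro borel_measurable_sum borel_measurable_scaleR) auto
  ultimately show ?thesis by (intro bexI)
qed

lemma set_integrable_borel_representative:
  fixes g g' :: "'a::euclidean_space \<Rightarrow> 'b::euclidean_space"
  assumes g: "g \<in> borel_measurable lebesgue" and [measurable]: "g' \<in> borel_measurable borel"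
    and ae: "AE x in lborel. g x = g' x" and int: "set_integrable lebesgue (cbox a b) g"
  shows "set_integrable lborel (cbox a b) g'"
proof -
  have [measurable]: "g' \<in> borel_measurable lebesgue"
    by (rule measurable_completion) simp
  have [measurable]: "cbox a b \<in> sets lebesgue" "g \<in> borel_measurable lebesgue"
    using g by auto
  have "integrable lebesgue (\<lambda>x. indicator (cbox a b) x *\<^sub>R g x) \<longleftrightarrow> integrable lebesgue (\<lambda>x. indicator (cbox a b) x *\<^sub>R g' x)"
  proof (rule integrable_cong_AE)
    show "AE x in lebesgue. indicator (cbox a b) x *\<^sub>R g x = indicator (cbox a b) x *\<^sub>R g' x"
      using AE_completion[OF ae] by eventually_elim simp
  qed measurable
  then have "integrable lebesgue (\<lambda>x. indicator (cbox a b) x *\<^sub>R g' x)"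
    using int unfolding set_integrable_def by blast
  then show ?thesis
    unfolding set_integrable_def by (subst (asm) integrable_completion) measurable
qed

text \<open>The congruence is applied first in the outer and then in the inner variable, so no
  measurability of \<open>H\<close> on a product enters.\<close>

lemma nn_integral2_cong_AE:
  assumes "AE x in M. f x = f' x"
  shows "(\<integral>\<^sup>+z. (\<integral>\<^sup>+x. H z x (f z) (f x) \<partial>M) \<partial>M) = (\<integral>\<^sup>+z. (\<integral>\<^sup>+x. H z x (f' z) (f' x) \<partial>M) \<partial>M)"
proof (rule nn_integral_cong_AE, use assms in eventually_elim)
  case (elim z)
  show ?case
    by (rule nn_integral_cong_AE, use assms in eventually_elim) (simp add: elim)
qed

text \<open>\<open>K\<close> is chosen before \<open>f\<close>, so it depends on p, r and N only.
  \<open>B\<close> is any positive upper bound of the seminorm, because the seminorm itself may be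
  0.\<close>

lemma gagliardo_energy_le_weak_gradient:
  assumes r: "1 < r" "r < p"
  shows "\<exists>K\<ge>0. \<forall>(f :: 'a::euclidean_space \<Rightarrow> real) Df B.
    f \<in> Lp_space r UNIV \<longrightarrow> Df \<in> Lp_space r UNIV \<longrightarrow> has_weak_gradient UNIV f Df \<longrightarrow>
    0 < B \<longrightarrow> bmo_seminorm UNIV f \<le> ennreal B \<longrightarrow>
    (\<integral>\<^sup>+z. (\<integral>\<^sup>+x. ennreal (\<bar>f x - f z\<bar> powr p / norm (x - z) powr (r + real DIM('a))) \<partial>lborel) \<partial>lborel)
      \<le> ennreal (K * B powr (p - r)) * (\<integral>\<^sup>+x. ennreal (norm (Df x) powr r) \<partial>lborel)"
proof -
  define c where "c = 2 ^ DIM('a) * real DIM('a)"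
  \<comment> \<open>\<open>C3\<close> depends only on the dimension, \<open>p\<close>,
    \<open>r\<close> and \<open>c\<close>, so it can be named before any \<open>f\<close> is given;
    the maximum makes it nonnegative at once.\<close>
  define L where "L = max 0 (oscillation_bounds.C3 TYPE('a) p r c)"
  define \<kappa> where "\<kappa> = enn2real (radial_const p r TYPE('a))"
  have \<kappa>: "radial_const p r TYPE('a) = ennreal \<kappa>"
    using radial_const_finite[OF r, where 'a='a] by (simp add: \<kappa>_def)
  have nonneg: "0 \<le> L" "0 \<le> \<kappa>" by (auto simp: L_def \<kappa>_def)
  show ?thesis
  proof (intro exI[of _ "L * \<kappa>"] conjI allI impI)
    show "0 \<le> L * \<kappa>" using nonneg by simp
    fix f :: "'a \<Rightarrow> real" and Df :: "'a \<Rightarrow> 'a" and B :: real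
    assume f: "f \<in> Lp_space r UNIV" and Df: "Df \<in> Lp_space r UNIV" and wg: "has_weak_gradient UNIV f Df"
      and B: "0 < B" "bmo_seminorm UNIV f \<le> ennreal B"
    have meas: "f \<in> borel_measurable lebesgue" "Df \<in> borel_measurable lebesgue"
      using f Df by (auto simp: Lp_space_def set_borel_measurable_def)
    obtain f' where f' [measurable]: "f' \<in> borel_measurable borel" and f'_ae: "AE x in lborel. f x = f' x"
      using ex_borel_representative[OF meas(1)] by auto
    obtain g where g [measurable]: "g \<in> borel_measurable borel" and g_ae: "AE x in lborel. Df x = g x"
      using ex_borel_representative[OF meas(2)] by auto
    have [measurable]: "f' \<in> borel_measurable lebesgue" "g \<in> borel_measurable lebesgue"
      by (auto intro!: measurable_completion)
    interpret weak_gradient f' g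
    proof
      show "set_integrable lborel (cbox a b) f'" for a b
        by (rule set_integrable_borel_representative[OF meas(1) f' f'_ae])
          (use wg in \<open>auto simp: has_weak_gradient_def loc_integrable_def\<close>)
      show "set_integrable lborel (cbox a b) g" for a b
        by (rule set_integrable_borel_representative[OF meas(2) g g_ae])
          (use wg in \<open>auto simp: has_weak_gradient_def loc_integrable_def\<close>)
      fix \<phi> :: "'a \<Rightarrow> real" and i :: 'a
      assume \<phi>: "test_function UNIV \<phi>" and i: "i \<in> Basis"
      have [measurable]: "(\<lambda>x. frechet_derivative \<phi> (at x) i) \<in> borel_measurable borel"
        by (rule borel_measurable_continuous_onI[OF frechet_derivative_test_function(2)[OF \<phi>]])
      have "cont_diff 0 \<phi>" using \<phi> unfolding test_function_def by blast
      then have [measurable]: "\<phi> \<in> borel_measurable borel"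
        by (simp add: borel_measurable_continuous_onI)
      have [measurable]: "(\<lambda>x. frechet_derivative \<phi> (at x) i) \<in> borel_measurable lebesgue" "\<phi> \<in> borel_measurable lebesgue"
        by (auto intro!: measurable_completion)
      have "(\<integral>x. f' x * frechet_derivative \<phi> (at x) i \<partial>lborel) = (\<integral>x. f' x * frechet_derivative \<phi> (at x) i \<partial>lebesgue)"
        by (rule integral_completion[symmetric]) measurable
      also have "\<dots> = (\<integral>x. f x * frechet_derivative \<phi> (at x) i \<partial>lebesgue)"
        using meas AE_completion[OF f'_ae] by (intro integral_cong_AE) auto
      also have "\<dots> = - (\<integral>x. (Df x \<bullet> i) * \<phi> x \<partial>lebesgue)"
        using wg \<phi> i unfolding has_weak_gradient_def set_lebesgue_integral_def by simp
      also have "(\<integral>x. (Df x \<bullet> i) * \<phi> x \<partial>lebesgue) = (\<integral>x. (g x \<bullet> i) * \<phi> x \<partial>lebesgue)"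
        using meas AE_completion[OF g_ae] by (intro integral_cong_AE) auto
      also have "\<dots> = (\<integral>x. (g x \<bullet> i) * \<phi> x \<partial>lborel)"
        by (rule integral_completion) measurable
      finally show "(\<integral>x. f' x * frechet_derivative \<phi> (at x) i \<partial>lborel) = - (\<integral>x. (g x \<bullet> i) * \<phi> x \<partial>lborel)" .
    qed auto
    have osc: "cube_osc f' t x \<le> ennreal B" if t: "0 < t" for t x
    proof -
      let ?Q = "cbox x (x + t *\<^sub>R One)"
      define T where "T = ennreal (t ^ DIM('a))"
      have T: "T \<noteq> 0" "T \<noteq> top" using t by (auto simp: T_def)
      have Q: "?Q \<in> {Q \<in> cubes. Q \<subseteq> UNIV}"
      proof -
        have "\<exists>l>0. \<forall>i\<in>Basis. (x + t *\<^sub>R One) \<bullet> i - x \<bullet> i = l"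
          using t by (intro exI[of _ t]) (auto simp: inner_simps)
        then show ?thesis unfolding cubes_def by blast
      qed
      have em: "emeasure lebesgue ?Q = T"
        using t by (simp add: T_def emeasure_lborel_cbox_eq inner_simps)
      have "T * (T * cube_osc f' t x) = (\<integral>\<^sup>+z\<in>?Q. (\<integral>\<^sup>+y\<in>?Q. ennreal \<bar>f' z - f' y\<bar> \<partial>lborel) \<partial>lborel)"
        unfolding T_def using t by (intro cube_osc_eq_nn_integral) auto
      also have "\<dots> = (\<integral>\<^sup>+z. (\<integral>\<^sup>+y. ennreal \<bar>f' z - f' y\<bar> * indicator ?Q y * indicator ?Q z \<partial>lborel) \<partial>lborel)"
        by (subst nn_integral_multc) auto
      also have "\<dots> = (\<integral>\<^sup>+z. (\<integral>\<^sup>+y. ennreal \<bar>f z - f y\<bar> * indicator ?Q y * indicator ?Q z \<partial>lborel) \<partial>lborel)"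
        using nn_integral2_cong_AE[OF f'_ae, of "\<lambda>z y fz fy. ennreal \<bar>fz - fy\<bar> * indicator ?Q y * indicator ?Q z"] by simp
      also have "\<dots> = (\<integral>\<^sup>+z\<in>?Q. (\<integral>\<^sup>+y\<in>?Q. ennreal \<bar>f z - f y\<bar> \<partial>lborel) \<partial>lborel)"
        by (intro nn_integral_cong) (auto simp: indicator_def)
      \<comment> \<open>Division by the squared volume is legitimate in the extended reals because
        \<open>T\<close> is neither 0 nor infinite.\<close>
      finally have "(\<integral>\<^sup>+z\<in>?Q. (\<integral>\<^sup>+y\<in>?Q. ennreal \<bar>f z - f y\<bar> \<partial>lebesgue) \<partial>lebesgue) / (emeasure lebesgue ?Q)\<^sup>2 = cube_osc f' t x * (T * T) / (T * T)"
        unfolding em nn_integral_completion by (simp add: power2_eq_square mult_ac)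
      also have "\<dots> = cube_osc f' t x"
        using T by (intro mult_divide_eq_ennreal) (auto simp: ennreal_mult_eq_top_iff)
      finally have "cube_osc f' t x \<le> bmo_seminorm UNIV f"
        unfolding bmo_seminorm_def by (intro SUP_upper2[OF Q]) simp
      with B show ?thesis by simp
    qed
    interpret oscillation_bounds f' "\<lambda>x. norm (g x)" p r B c
      by unfold_locales (use r B osc cube_poincare f_int in \<open>auto simp: c_def\<close>)
    have "(\<integral>\<^sup>+z. (\<integral>\<^sup>+x. ennreal (\<bar>f x - f z\<bar> powr p / norm (x - z) powr (r + real DIM('a))) \<partial>lborel) \<partial>lborel)
      = (\<integral>\<^sup>+z. (\<integral>\<^sup>+x. ennreal (\<bar>f' x - f' z\<bar> powr p / norm (x - z) powr (r + real DIM('a))) \<partial>lborel) \<partial>lborel)"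
      by (rule nn_integral2_cong_AE[OF f'_ae, of "\<lambda>z x fz fx. ennreal (\<bar>fx - fz\<bar> powr p / norm (x - z) powr (r + real DIM('a)))"])
    also have "\<dots> \<le> ennreal L * (ennreal (B powr (p - r)) * radial_const p r TYPE('a) * M)"
      using gagliardo_energy_le by (rule order_trans) (intro mult_right_mono ennreal_leI, auto simp: L_def)
    also have "M = (\<integral>\<^sup>+x. ennreal (norm (Df x) powr r) \<partial>lborel)"
      unfolding M_def by (intro nn_integral_cong_AE) (use g_ae in auto)
    also have "ennreal L * (ennreal (B powr (p - r)) * radial_const p r TYPE('a) * (\<integral>\<^sup>+x. ennreal (norm (Df x) powr r) \<partial>lborel))
      = ennreal (L * \<kappa> * B powr (p - r)) * (\<integral>\<^sup>+x. ennreal (norm (Df x) powr r) \<partial>lborel)"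
      unfolding \<kappa> using nonneg by (simp add: ennreal_mult' mult_ac)
    finally show "(\<integral>\<^sup>+z. (\<integral>\<^sup>+x. ennreal (\<bar>f x - f z\<bar> powr p / norm (x - z) powr (r + real DIM('a))) \<partial>lborel) \<partial>lborel)
      \<le> ennreal (L * \<kappa> * B powr (p - r)) * (\<integral>\<^sup>+x. ennreal (norm (Df x) powr r) \<partial>lborel)" .
  qed
qed

section \<open>Powers of extended reals and the final estimate\<close>

lemma enn_powr_ennreal: "0 \<le> x \<Longrightarrow> enn_powr (ennreal x) a = ennreal (x powr a)"
  by (simp add: enn_powr_def)

lemma enn_powr_mono:
  assumes "x \<le> y" "0 \<le> a"
  shows "enn_powr x a \<le> enn_powr y a"
proof (cases "y = top")
  case False
  then have "x \<noteq> top" using assms by (auto simp: top_unique)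
  with False assms show ?thesis
    by (auto simp: enn_powr_def less_top intro!: ennreal_leI powr_mono2 enn2real_mono)
qed (simp add: enn_powr_def)

lemma enn_powr_mult:
  assumes "x \<noteq> top" "y \<noteq> top"
  shows "enn_powr (x * y) a = enn_powr x a * enn_powr y a"
  using assms
  by (simp add: enn_powr_def ennreal_mult_eq_top_iff enn2real_mult powr_mult ennreal_mult)

text \<open>For positive \<open>\<beta>\<close> take \<open>B = \<beta>\<close>. For
  \<open>\<beta> = 0\<close>, the case of vanishing BMO seminorm, small values of \<open>B\<close>
  force \<open>E = 0\<close>.\<close>

lemma ennreal_le_powr_limit:
  assumes q: "0 < q" and \<beta>: "0 \<le> \<beta>" and k: "0 \<le> k"
    and le: "\<And>B. 0 < B \<Longrightarrow> \<beta> \<le> B \<Longrightarrow> E \<le> ennreal (k * B powr q)"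
  shows "E \<le> ennreal (k * \<beta> powr q)"
proof (cases "\<beta> = 0")
  case True
  have "E = 0"
  proof (rule ccontr)
    assume "E \<noteq> 0"
    have "E < top"
      using le[of 1] True by (simp add: le_less_trans)
    then obtain e where e: "E = ennreal e" "0 \<le> e"
      by (metis ennreal_cases less_irrefl top.extremum_strict infinity_ennreal_def)
    with \<open>E \<noteq> 0\<close> have "0 < e" by (cases "e = 0") auto
    \<comment> \<open>With B^q = delta the bound k delta stays below e / 2; adding 1 to
      \<open>k\<close> avoids a zero denominator.\<close>
    define \<delta> where "\<delta> = e / (2 * (k + 1))"
    have \<delta>: "0 < \<delta>" using \<open>0 < e\<close> k by (simp add: \<delta>_def)
    have "E \<le> ennreal (k * (\<delta> powr (1 / q)) powr q)"
      using \<delta> True by (intro le) auto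
    then have "e \<le> k * \<delta>"
      using \<delta> q k e by (simp add: powr_powr)
    also have "\<dots> \<le> (k + 1) * \<delta>" using \<delta> by simp
    also have "\<dots> = e / 2" using k by (simp add: \<delta>_def field_simps)
    finally show False using \<open>0 < e\<close> by simp
  qed
  then show ?thesis by simp
next
  case False
  then show ?thesis using le[of \<beta>] \<beta> by simp
qed

theorem theorem1p11:
  fixes p s C\<^sub>0 :: real and \<Omega> :: "'a::euclidean_space set"
  assumes "1 < p" and "1 / p < s" and "s < 1" and "open \<Omega>"
  shows "\<exists>C::real. \<forall>u Du.
    u \<in> sobolev_W1 (s * p) \<Omega> \<inter> BMO \<Omega> \<and>
    has_weak_gradient \<Omega> u Du \<and> Du \<in> Lp_space (s * p) \<Omega> \<and>
    (\<exists>f Df. f \<in> sobolev_W1 (s * p) UNIV \<inter> BMO UNIV \<and>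
       has_weak_gradient UNIV f Df \<and> Df \<in> Lp_space (s * p) UNIV \<and>
       (AE x in lebesgue. x \<in> \<Omega> \<longrightarrow> f x = u x) \<and>
       bmo_seminorm UNIV f \<le> ennreal C\<^sub>0 * bmo_seminorm \<Omega> u \<and>
       Lp_norm (s * p) UNIV Df \<le> ennreal C\<^sub>0 * Lp_norm (s * p) \<Omega> Du)
    \<longrightarrow> gagliardo_seminorm s p \<Omega> u
          \<le> ennreal C * enn_powr (Lp_norm (s * p) \<Omega> Du) s * enn_powr (bmo_seminorm \<Omega> u) (1 - s)"
proof -
  define r where "r = s * p"
  have s: "0 < s" using assms by (meson divide_pos_pos less_trans zero_less_one)
  have r: "1 < r" "r < p"
    using assms s by (auto simp: r_def field_simps)
  obtain K where K: "0 \<le> K" and energy_all: "\<forall>(f :: 'a \<Rightarrow> real) Df B.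
    f \<in> Lp_space r UNIV \<longrightarrow> Df \<in> Lp_space r UNIV \<longrightarrow> has_weak_gradient UNIV f Df \<longrightarrow>
    0 < B \<longrightarrow> bmo_seminorm UNIV f \<le> ennreal B \<longrightarrow>
    (\<integral>\<^sup>+z. (\<integral>\<^sup>+x. ennreal (\<bar>f x - f z\<bar> powr p / norm (x - z) powr (r + real DIM('a))) \<partial>lborel) \<partial>lborel)
      \<le> ennreal (K * B powr (p - r)) * (\<integral>\<^sup>+x. ennreal (norm (Df x) powr r) \<partial>lborel)"
    using gagliardo_energy_le_weak_gradient[OF r, where 'a='a] by (elim exE conjE) (rule that; assumption)
  note energy = energy_all[rule_format]
  \<comment> \<open>The embedding into the extended nonnegative reals sends negative numbers to 0,
    so the positive part represents the same constant.\<close>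
  define c0 where "c0 = max 0 C\<^sub>0"
  have c0: "ennreal C\<^sub>0 = ennreal c0" "0 \<le> c0"
    by (auto simp: c0_def max_def ennreal_neg)
  show ?thesis
    unfolding r_def[symmetric]
  \<comment> \<open>\<open>K powr (1 / p)\<close> comes from the p-th root of the energy; the powers
    of \<open>c0\<close> come from replacing the two norms of the extension by those of
    \<open>u\<close>.\<close>
  proof (intro exI[of _ "K powr (1 / p) * (c0 powr s * c0 powr (1 - s))"] allI impI, elim conjE exE)
    fix u :: "'a \<Rightarrow> real" and Du :: "'a \<Rightarrow> 'a" and f :: "'a \<Rightarrow> real" and Df :: "'a \<Rightarrow> 'a"
    assume u: "u \<in> sobolev_W1 r \<Omega> \<inter> BMO \<Omega>" and Du: "Du \<in> Lp_space r \<Omega>"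
      and f: "f \<in> sobolev_W1 r UNIV \<inter> BMO UNIV" and wg: "has_weak_gradient UNIV f Df" and Df: "Df \<in> Lp_space r UNIV"
      and ae: "AE x in lebesgue. x \<in> \<Omega> \<longrightarrow> f x = u x"
      and bmo_le: "bmo_seminorm UNIV f \<le> ennreal C\<^sub>0 * bmo_seminorm \<Omega> u"
      and Lp_le: "Lp_norm r UNIV Df \<le> ennreal C\<^sub>0 * Lp_norm r \<Omega> Du"
    define E where "E = (\<integral>\<^sup>+z. (\<integral>\<^sup>+x. ennreal (\<bar>f x - f z\<bar> powr p / norm (x - z) powr (r + real DIM('a))) \<partial>lborel) \<partial>lborel)"
    define J where "J = (\<integral>\<^sup>+x. ennreal (norm (Df x) powr r) \<partial>lborel)"
    have fL: "f \<in> Lp_space r UNIV" using f by (simp add: sobolev_W1_def)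
    have XJ: "Lp_norm r UNIV Df = enn_powr J (1 / r)"
      by (simp add: Lp_norm_def J_def nn_integral_completion)
    have "J \<noteq> top"
      using Df by (auto simp: Lp_space_def XJ enn_powr_def)
    then obtain \<iota> where \<iota>: "J = ennreal \<iota>" "0 \<le> \<iota>"
      by (metis ennreal_cases infinity_ennreal_def)
    have "bmo_seminorm UNIV f \<noteq> top"
      using f by (auto simp: BMO_def)
    then obtain \<beta> where \<beta>: "bmo_seminorm UNIV f = ennreal \<beta>" "0 \<le> \<beta>"
      by (metis ennreal_cases infinity_ennreal_def)
    have "E \<le> ennreal (K * \<iota> * \<beta> powr (p - r))"
    proof (rule ennreal_le_powr_limit)
      fix B assume "0 < B" "\<beta> \<le> B"
      then have "E \<le> ennreal (K * B powr (p - r)) * ennreal \<iota>"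
        unfolding E_def \<iota>(1)[symmetric] J_def by (intro energy fL Df wg) (auto simp: \<beta> intro: ennreal_leI)
      then show "E \<le> ennreal (K * \<iota> * B powr (p - r))"
        using K \<iota> by (simp add: ennreal_mult'[symmetric] mult_ac)
    qed (use r K \<iota> \<beta> in auto)
    then have "enn_powr E (1 / p) \<le> enn_powr (ennreal (K * \<iota> * \<beta> powr (p - r))) (1 / p)"
      using assms by (intro enn_powr_mono) auto
    also have "\<dots> = ennreal (K powr (1 / p) * \<iota> powr (1 / p) * \<beta> powr (1 - s))"
    proof -
      have "(p - r) * (1 / p) = 1 - s"
        using assms by (simp add: r_def field_simps)
      then show ?thesis
        using K \<iota> by (simp add: enn_powr_ennreal powr_mult powr_powr)
    qed
    also have "\<dots> = ennreal (K powr (1 / p)) * enn_powr (Lp_norm r UNIV Df) s * enn_powr (bmo_seminorm UNIV f) (1 - s)"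
    proof -
      \<comment> \<open>The norm of \<open>Df\<close> is iota^(1/r), and r = s p, so its power s is
        exactly iota^(1/p).\<close>
      have "1 / r * s = 1 / p"
        using assms s by (simp add: r_def)
      then have "enn_powr (Lp_norm r UNIV Df) s = ennreal (\<iota> powr (1 / p))"
        unfolding XJ \<iota> using \<iota>(2) by (simp add: enn_powr_ennreal powr_powr)
      moreover have "enn_powr (bmo_seminorm UNIV f) (1 - s) = ennreal (\<beta> powr (1 - s))"
        unfolding \<beta> using \<beta>(2) by (rule enn_powr_ennreal)
      ultimately show ?thesis by (simp only: ennreal_mult' powr_ge_zero mult_nonneg_nonneg)
    qed
    also have "\<dots> \<le> ennreal (K powr (1 / p)) * (ennreal (c0 powr s) * enn_powr (Lp_norm r \<Omega> Du) s)
        * (ennreal (c0 powr (1 - s)) * enn_powr (bmo_seminorm \<Omega> u) (1 - s))"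
    proof (intro mult_mono)
      have fin: "Lp_norm r \<Omega> Du \<noteq> top" "bmo_seminorm \<Omega> u \<noteq> top"
        using Du u by (auto simp: Lp_space_def BMO_def)
      show "enn_powr (Lp_norm r UNIV Df) s \<le> ennreal (c0 powr s) * enn_powr (Lp_norm r \<Omega> Du) s"
        using enn_powr_mono[OF Lp_le, of s] s fin c0 by (simp add: enn_powr_mult enn_powr_ennreal)
      show "enn_powr (bmo_seminorm UNIV f) (1 - s) \<le> ennreal (c0 powr (1 - s)) * enn_powr (bmo_seminorm \<Omega> u) (1 - s)"
        using enn_powr_mono[OF bmo_le, of "1 - s"] assms fin c0 by (simp add: enn_powr_mult enn_powr_ennreal)
    qed auto
    also have "\<dots> = ennreal (K powr (1 / p) * (c0 powr s * c0 powr (1 - s))) * enn_powr (Lp_norm r \<Omega> Du) s * enn_powr (bmo_seminorm \<Omega> u) (1 - s)"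
      by (simp only: ennreal_mult' powr_ge_zero) (simp only: mult_ac)
    finally have main: "enn_powr E (1 / p) \<le> \<dots>" .
    have ae': "AE x in lborel. x \<in> \<Omega> \<longrightarrow> f x = u x"
      using ae by (simp add: AE_completion_iff)
    \<comment> \<open>On the product of \<open>\<Omega>\<close> with itself the integrands agree
      almost everywhere in each variable; the remaining part of the energy of \<open>f\<close> is
      nonnegative.\<close>
    have "gagliardo_seminorm s p \<Omega> u \<le> enn_powr E (1 / p)"
      unfolding gagliardo_seminorm_def E_def nn_integral_completion r_def
    proof (intro enn_powr_mono nn_integral_mono_AE)
      show "AE z in lborel. (\<integral>\<^sup>+x\<in>\<Omega>. ennreal (\<bar>u x - u z\<bar> powr p / norm (x - z) powr (s * p + real DIM('a))) \<partial>lborel) * indicator \<Omega> z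
        \<le> (\<integral>\<^sup>+x. ennreal (\<bar>f x - f z\<bar> powr p / norm (x - z) powr (s * p + real DIM('a))) \<partial>lborel)"
        using ae'
      proof eventually_elim
        case (elim z)
        show ?case
        proof (cases "z \<in> \<Omega>")
          case True
          have "(\<integral>\<^sup>+x\<in>\<Omega>. ennreal (\<bar>u x - u z\<bar> powr p / norm (x - z) powr (s * p + real DIM('a))) \<partial>lborel)
            \<le> (\<integral>\<^sup>+x. ennreal (\<bar>f x - f z\<bar> powr p / norm (x - z) powr (s * p + real DIM('a))) \<partial>lborel)"
            by (rule nn_integral_mono_AE, use ae' in eventually_elim) (use elim True in \<open>auto simp: indicator_def\<close>)
          then show ?thesis using True by simp
        qed simp
      qed
    qed (use assms in auto)
    then show "gagliardo_seminorm s p \<Omega> u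
        \<le> ennreal (K powr (1 / p) * (c0 powr s * c0 powr (1 - s))) * enn_powr (Lp_norm r \<Omega> Du) s * enn_powr (bmo_seminorm \<Omega> u) (1 - s)"
      using main by (rule order_trans)
  qed
qed

end
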